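(* Let $\mathcal{H}$ be a separable infinite-dimensional Hilbert space and $\mathcal{L}=\mathcal{L}(\mathcal{H})$ its space of bounded linear transformations. Then $\mathrm{BMOA}_{\mathcal{C}}(\mathcal{L})$ is not closed under the map $\phi\mapsto\phi^\#$, where $\phi^\#(z)=\phi(\overline{z})^*$. In particular, $$\mathrm{BMOA}_{\mathcal{C}}(\mathcal{L})\ne \mathrm{BMOA}_{\mathcal{N}\mathcal{P}}(\mathcal{L}).$$
   Context: $\mathbb{D}$ is the open unit disc in $\mathbb{C}$ and $dA$ is area measure. For a Banach space $\mathcal{Y}$, $\mathrm{Hol}(\mathcal{Y})$ is the space of $\mathcal{Y}$-valued analytic functions on $\mathbb{D}$, $\hat f(n)$ is the $n$th Taylor coefficient of $f$ at the origin, and $\mathcal{O}(\mathcal{Y})$ is the set of $f\in\mathrm{Hol}(\mathcal{Y})$ that extend analytically to a larger disc centered at the origin. $H^2(\mathcal{H})$ is the Hardy space with $\|f\|_{H^2(\mathcal{H})}^2=\sum_{n\ge0}\|\hat f(n)\|_{\mathcal{H}}^2$ (value $\infty$ allowed), and $\mathcal{O}_1(\mathcal{H})=\{f\in\mathcal{O}(\mathcal{H}):\|f\|_{H^2(\mathcal{H})}=1\}$. $Df(z)=\sum_{n\ge 0}(1+n)\hat f(n)z^n=zf'(z)+f(z)$. For $\phi\in\mathrm{Hol}(\mathcal{L})$ and $f\in\mathcal{O}(\mathcal{H})$, $\Gamma_\phi f(z)=\sum_{n\ge0}\left(\sum_{m\ge0}\hat\phi(m+n)\hat f(m)\right)z^n$.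 $\mathrm{BMOA}_{\mathcal{C}}(\mathcal{L})$ is the set of $\phi\in\mathrm{Hol}(\mathcal{L})$ with $\|\phi\|_{\mathrm{BMOA}_{\mathcal{C}}}^2=\sup_{f\in\mathcal{O}_1(\mathcal{H})}\int_{\mathbb{D}}\|(D\phi)(z)f(\overline z)\|_{\mathcal{H}}^2(1-|z|^2)\,dA(z)<\infty$. $\mathrm{BMOA}_{\mathcal{N}\mathcal{P}}(\mathcal{L})$ is the set of $\phi\in\mathrm{Hol}(\mathcal{L})$ with $\sup_{f\in\mathcal{O}_1(\mathcal{H})}\|\Gamma_\phi f\|_{H^2(\mathcal{H})}<\infty$. $A^*$ denotes the Hilbert space adjoint of $A\in\mathcal{L}$. *)

theory Defs
  imports "HOL-Analysis.Analysis"
begin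

section \<open>Complex Hilbert spaces\<close>

class complex_vector = real_vector +
  fixes scaleC :: "complex \<Rightarrow> 'a \<Rightarrow> 'a"  (infixr \<open>*\<^sub>C\<close> 75)
  assumes scaleC_add_right: "c *\<^sub>C (x + y) = c *\<^sub>C x + c *\<^sub>C y"
    and scaleC_add_left: "(c + d) *\<^sub>C x = c *\<^sub>C x + d *\<^sub>C x"
    and scaleC_scaleC: "c *\<^sub>C (d *\<^sub>C x) = (c * d) *\<^sub>C x"
    and scaleC_of_real: "complex_of_real r *\<^sub>C x = r *\<^sub>R x"

class complex_normed_vector = complex_vector + real_normed_vector +
  assumes norm_scaleC: "norm (c *\<^sub>C x) = cmod c * norm x"

class cbanach = complex_normed_vector + banach

class complex_inner = complex_normed_vector +
  fixes cinner :: "'a \<Rightarrow> 'a \<Rightarrow> complex"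
  assumes cinner_commute: "cinner x y = cnj (cinner y x)"
    and cinner_add_left: "cinner (x + y) z = cinner x z + cinner y z"
    and cinner_scaleC_left: "cinner (c *\<^sub>C x) y = c * cinner x y"
    and cinner_self: "cinner x x = complex_of_real ((norm x)\<^sup>2)"

class chilbert_space = complex_inner + cbanach

lemma vector_space_scaleC:
  "vector_space (scaleC :: complex \<Rightarrow> 'a \<Rightarrow> 'a::complex_vector)"
proof
  show "1 *\<^sub>C x = x" for x :: 'a
    using scaleC_of_real[of 1 x] by simp
qed (simp_all add: scaleC_add_right scaleC_add_left scaleC_scaleC)

interpretation complex_vector:
  vector_space "scaleC :: complex \<Rightarrow> 'a \<Rightarrow> 'a::complex_vector"
  by (rule vector_space_scaleC)

definition infinite_dimensional :: "'a::complex_vector itself \<Rightarrow> bool" where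
  "infinite_dimensional _ \<longleftrightarrow>
     \<not> (\<exists>B :: 'a set. finite B \<and> complex_vector.span B = UNIV)"


section \<open>Bounded complex-linear operators\<close>

text \<open>
  The complex-linear operators among the real-linear bounded ones; algebraic structure,
  operator norm and topology are inherited from \<^typ>\<open>'a \<Rightarrow>\<^sub>L 'b\<close>.
\<close>

typedef (overloaded) ('a, 'b) cblinfun =
  "{A :: 'a::complex_normed_vector \<Rightarrow>\<^sub>L 'b::complex_normed_vector.
      \<forall>c x. blinfun_apply A (c *\<^sub>C x) = c *\<^sub>C blinfun_apply A x}"
  morphisms blinfun_of_cblinfun Abs_cblinfun
  by (rule exI[of _ 0]) simp

setup_lifting type_definition_cblinfun

lift_definition cblinfun_apply ::
  "('a::complex_normed_vector, 'b::complex_normed_vector) cblinfun \<Rightarrow> 'a \<Rightarrow> 'b"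
  is blinfun_apply .

lemma bounded_linear_scaleC_right:
  "bounded_linear (\<lambda>x :: 'a::complex_normed_vector. c *\<^sub>C x)"
proof (rule bounded_linear_intro)
  show "c *\<^sub>C (r *\<^sub>R x) = r *\<^sub>R (c *\<^sub>C x)" for r and x :: 'a
    by (simp flip: scaleC_of_real add: scaleC_scaleC mult.commute)
  show "norm (c *\<^sub>C x) \<le> norm x * cmod c" for x :: 'a
    by (simp add: norm_scaleC mult.commute)
qed (rule scaleC_add_right)

instantiation cblinfun :: (complex_normed_vector, complex_normed_vector) complex_normed_vector
begin

lift_definition zero_cblinfun :: "('a, 'b) cblinfun" is 0 by simp

lift_definition plus_cblinfun :: "('a, 'b) cblinfun \<Rightarrow> ('a, 'b) cblinfun \<Rightarrow> ('a, 'b) cblinfun"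
  is "(+)" by (simp add: blinfun.add_left scaleC_add_right)

lift_definition uminus_cblinfun :: "('a, 'b) cblinfun \<Rightarrow> ('a, 'b) cblinfun"
  is uminus by (simp add: blinfun.minus_left)

lift_definition minus_cblinfun :: "('a, 'b) cblinfun \<Rightarrow> ('a, 'b) cblinfun \<Rightarrow> ('a, 'b) cblinfun"
  is "(-)" by (simp add: blinfun.diff_left complex_vector.scale_right_diff_distrib)

lift_definition scaleR_cblinfun :: "real \<Rightarrow> ('a, 'b) cblinfun \<Rightarrow> ('a, 'b) cblinfun"
  is "(*\<^sub>R)"
  by (simp add: blinfun.scaleR_left scaleC_scaleC mult.commute flip: scaleC_of_real)

lift_definition scaleC_cblinfun :: "complex \<Rightarrow> ('a, 'b) cblinfun \<Rightarrow> ('a, 'b) cblinfun"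
  is "\<lambda>c A. blinfun_compose (Blinfun (\<lambda>x. c *\<^sub>C x)) A"
  by (simp add: bounded_linear_Blinfun_apply bounded_linear_scaleC_right scaleC_scaleC mult.commute)

lift_definition norm_cblinfun :: "('a, 'b) cblinfun \<Rightarrow> real" is norm .

lift_definition dist_cblinfun :: "('a, 'b) cblinfun \<Rightarrow> ('a, 'b) cblinfun \<Rightarrow> real" is dist .

definition sgn_cblinfun :: "('a, 'b) cblinfun \<Rightarrow> ('a, 'b) cblinfun" where
  "sgn_cblinfun A = inverse (norm A) *\<^sub>R A"

definition uniformity_cblinfun :: "(('a, 'b) cblinfun \<times> ('a, 'b) cblinfun) filter" where
  "uniformity_cblinfun = (INF e\<in>{0<..}. principal {(x, y). dist x y < e})"

definition open_cblinfun :: "('a, 'b) cblinfun set \<Rightarrow> bool" where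
  "open_cblinfun U \<longleftrightarrow> (\<forall>x\<in>U. eventually (\<lambda>(x', y). x' = x \<longrightarrow> y \<in> U) uniformity)"

instance
proof
  fix A B C :: "('a, 'b) cblinfun" and r s :: real and c d :: complex
  show "A + B + C = A + (B + C)" by transfer (rule add.assoc)
  show "A + B = B + A" by transfer (rule add.commute)
  show "0 + A = A" by transfer simp
  show "- A + A = 0" by transfer simp
  show "A - B = A + - B" by transfer simp
  show "r *\<^sub>R (A + B) = r *\<^sub>R A + r *\<^sub>R B" by transfer (rule scaleR_add_right)
  show "(r + s) *\<^sub>R A = r *\<^sub>R A + s *\<^sub>R A" by transfer (rule scaleR_add_left)
  show "r *\<^sub>R s *\<^sub>R A = (r * s) *\<^sub>R A" by transfer simp
  show "1 *\<^sub>R A = A" by transfer simp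
  note [simp] = bounded_linear_Blinfun_apply[OF bounded_linear_scaleC_right]
  show "c *\<^sub>C (A + B) = c *\<^sub>C A + c *\<^sub>C B"
    by transfer (rule blinfun_eqI, simp add: blinfun.add_left scaleC_add_right)
  show "(c + d) *\<^sub>C A = c *\<^sub>C A + d *\<^sub>C A"
    by transfer (rule blinfun_eqI, simp add: blinfun.add_left scaleC_add_left)
  show "c *\<^sub>C d *\<^sub>C A = (c * d) *\<^sub>C A"
    by transfer (rule blinfun_eqI, simp add: scaleC_scaleC)
  show "complex_of_real r *\<^sub>C A = r *\<^sub>R A"
    by transfer (rule blinfun_eqI, simp add: scaleC_of_real blinfun.scaleR_left)
  show "dist A B = norm (A - B)" by transfer (rule dist_norm)
  show "sgn A = inverse (norm A) *\<^sub>R A" by (rule sgn_cblinfun_def)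
  show "(norm A = 0) = (A = 0)" by transfer simp
  show "norm (A + B) \<le> norm A + norm B" by transfer (rule norm_triangle_ineq)
  show "norm (r *\<^sub>R A) = \<bar>r\<bar> * norm A" by transfer simp
  have le: "norm (c *\<^sub>C A) \<le> cmod c * norm A" for c and A :: "('a, 'b) cblinfun"
  proof (transfer, rule norm_blinfun_bound)
    fix c :: complex and A :: "'a \<Rightarrow>\<^sub>L 'b" and x
    have "cmod c * norm (blinfun_apply A x) \<le> cmod c * (norm A * norm x)"
      by (intro mult_left_mono norm_blinfun) simp
    then show "norm (blinfun_apply (Blinfun ((*\<^sub>C) c) o\<^sub>L A) x) \<le> cmod c * norm A * norm x"
      by (simp add: norm_scaleC mult.assoc)
  qed simp
  show "norm (c *\<^sub>C A) = cmod c * norm A"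
  proof (cases "c = 0")
    case True
    have "0 *\<^sub>C A = 0"
      by transfer (rule blinfun_eqI, simp)
    moreover have "norm (0 :: ('a, 'b) cblinfun) = 0"
      by transfer simp
    ultimately show ?thesis using True by simp
  next
    case False
    have "A = inverse c *\<^sub>C (c *\<^sub>C A)"
      using False
      by transfer (rule blinfun_eqI, simp add: scaleC_scaleC)
    then have "norm A \<le> cmod (inverse c) * norm (c *\<^sub>C A)"
      using le[of "inverse c" "c *\<^sub>C A"] by simp
    then have "cmod c * norm A \<le> norm (c *\<^sub>C A)"
      using False by (simp add: norm_divide divide_simps mult.commute)
    then show ?thesis using le[of c A] by linarith
  qed
qed (simp_all add: uniformity_cblinfun_def open_cblinfun_def)

end

instance cblinfun :: (complex_normed_vector, cbanach) cbanach
proof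
  fix X :: "nat \<Rightarrow> ('a, 'b) cblinfun"
  assume X: "Cauchy X"
  have dist_eq: "dist (blinfun_of_cblinfun A) (blinfun_of_cblinfun B) = dist A B"
    for A B :: "('a, 'b) cblinfun" by transfer simp
  have "Cauchy (\<lambda>n. blinfun_of_cblinfun (X n))"
    using X by (simp add: Cauchy_def dist_eq)
  then obtain L where L: "(\<lambda>n. blinfun_of_cblinfun (X n)) \<longlonglongrightarrow> L"
    using Cauchy_convergent convergent_def by blast
  have "blinfun_apply L (c *\<^sub>C x) = c *\<^sub>C blinfun_apply L x" for c x
  proof (rule LIMSEQ_unique)
    have lim: "(\<lambda>n. blinfun_apply (blinfun_of_cblinfun (X n)) y) \<longlonglongrightarrow> blinfun_apply L y" for y
      by (intro tendsto_intros L)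
    then show "(\<lambda>n. blinfun_apply (blinfun_of_cblinfun (X n)) (c *\<^sub>C x))
        \<longlonglongrightarrow> blinfun_apply L (c *\<^sub>C x)" .
    have "blinfun_apply (blinfun_of_cblinfun (X n)) (c *\<^sub>C x)
        = c *\<^sub>C blinfun_apply (blinfun_of_cblinfun (X n)) x" for n
      using blinfun_of_cblinfun[of "X n"] by simp
    then show "(\<lambda>n. blinfun_apply (blinfun_of_cblinfun (X n)) (c *\<^sub>C x))
        \<longlonglongrightarrow> c *\<^sub>C blinfun_apply L x"
      using bounded_linear.tendsto[OF bounded_linear_scaleC_right lim] by simp
  qed
  then have "blinfun_of_cblinfun (Abs_cblinfun L) = L"
    by (simp add: Abs_cblinfun_inverse)
  then have "X \<longlonglongrightarrow> Abs_cblinfun L"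
    using L by (simp add: tendsto_iff flip: dist_eq)
  then show "convergent X" by (auto simp: convergent_def)
qed

text \<open>Such an operator exists by the Riesz representation theorem, and is unique.\<close>

definition cadjoint ::
  "('a::chilbert_space, 'a) cblinfun \<Rightarrow> ('a, 'a) cblinfun" where
  "cadjoint A = (THE B. \<forall>x y. cinner (cblinfun_apply B x) y = cinner x (cblinfun_apply A y))"


section \<open>Vector-valued analytic functions on the unit disc\<close>

text \<open>
  Functions on the disc are represented by total functions on \<^typ>\<open>complex\<close>; none of the
  notions below depends on their values outside the open unit disc.
\<close>

definition has_complex_derivative ::
  "(complex \<Rightarrow> 'a::complex_normed_vector) \<Rightarrow> 'a \<Rightarrow> complex \<Rightarrow> bool" where
  "has_complex_derivative f D z \<longleftrightarrow> (f has_derivative (\<lambda>h. h *\<^sub>C D)) (at z)"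

definition complex_deriv ::
  "(complex \<Rightarrow> 'a::complex_normed_vector) \<Rightarrow> complex \<Rightarrow> 'a" where
  "complex_deriv f z = (THE D. has_complex_derivative f D z)"

text \<open>Used for open sets only.\<close>

definition analytic_in ::
  "(complex \<Rightarrow> 'a::complex_normed_vector) \<Rightarrow> complex set \<Rightarrow> bool" where
  "analytic_in f S \<longleftrightarrow> (\<forall>z\<in>S. \<exists>D. has_complex_derivative f D z)"

definition taylor_coeff ::
  "(complex \<Rightarrow> 'a::complex_normed_vector) \<Rightarrow> nat \<Rightarrow> 'a" where
  "taylor_coeff f n = (1 / fact n) *\<^sub>R (complex_deriv ^^ n) f 0"

abbreviation unit_disc :: "complex set" where
  "unit_disc \<equiv> ball 0 1"

definition Hol :: "(complex \<Rightarrow> 'a::cbanach) set" where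
  "Hol = {f. analytic_in f unit_disc}"

definition Hol_ext :: "(complex \<Rightarrow> 'a::cbanach) set" where
  "Hol_ext = {f \<in> Hol. \<exists>r>1. \<exists>g. analytic_in g (ball 0 r) \<and> (\<forall>z\<in>unit_disc. g z = f z)}"

definition esqrt :: "ennreal \<Rightarrow> ennreal" where
  "esqrt x = (if x = \<infinity> then \<infinity> else ennreal (sqrt (enn2real x)))"

definition H2_norm :: "(complex \<Rightarrow> 'a::chilbert_space) \<Rightarrow> ennreal" where
  "H2_norm f = esqrt (\<Sum>n. ennreal ((norm (taylor_coeff f n))\<^sup>2))"

definition Hol_ext1 :: "(complex \<Rightarrow> 'a::chilbert_space) set" where
  "Hol_ext1 = {f \<in> Hol_ext. H2_norm f = 1}"

definition Dop :: "(complex \<Rightarrow> 'a::cbanach) \<Rightarrow> complex \<Rightarrow> 'a" where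
  "Dop f z = (\<Sum>n. z ^ n *\<^sub>C (of_nat (1 + n) *\<^sub>C taylor_coeff f n))"

definition hankel ::
  "(complex \<Rightarrow> ('a::chilbert_space, 'a) cblinfun) \<Rightarrow> (complex \<Rightarrow> 'a) \<Rightarrow> complex \<Rightarrow> 'a" where
  "hankel \<phi> f z =
     (\<Sum>n. z ^ n *\<^sub>C (\<Sum>m. cblinfun_apply (taylor_coeff \<phi> (m + n)) (taylor_coeff f m)))"


section \<open>Operator-valued BMOA spaces\<close>

definition BMOA_C_norm :: "(complex \<Rightarrow> ('a::chilbert_space, 'a) cblinfun) \<Rightarrow> ennreal" where
  "BMOA_C_norm \<phi> = esqrt (SUP f\<in>Hol_ext1. \<integral>\<^sup>+ z\<in>unit_disc.
     ennreal ((norm (cblinfun_apply (Dop \<phi> z) (f (cnj z))))\<^sup>2 * (1 - (cmod z)\<^sup>2)) \<partial>lborel)"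

definition BMOA_C :: "(complex \<Rightarrow> ('a::chilbert_space, 'a) cblinfun) set" where
  "BMOA_C = {\<phi> \<in> Hol. BMOA_C_norm \<phi> < \<infinity>}"

definition BMOA_NP :: "(complex \<Rightarrow> ('a::chilbert_space, 'a) cblinfun) set" where
  "BMOA_NP = {\<phi> \<in> Hol. (SUP f\<in>Hol_ext1. H2_norm (hankel \<phi> f)) < \<infinity>}"

definition sharp ::
  "(complex \<Rightarrow> ('a::chilbert_space, 'a) cblinfun) \<Rightarrow> complex \<Rightarrow> ('a, 'a) cblinfun" where
  "sharp \<phi> z = cadjoint (\<phi> (cnj z))"

end

theory Submission
  imports Defs "HOL-Complex_Analysis.Cauchy_Integral_Formula"
begin

text \<open>
  For an orthonormal sequence \<open>e\<^sub>n\<close> take the symbol with Taylor coefficients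
  \<open>(n + 1)\<^sup>-\<^sup>1\<^sup>/\<^sup>2 \<langle>\<cdot>, e\<^sub>n\<rangle> e\<^sub>0\<close>. Writing
  \<open>f\<^sub>n = \<langle>f, e\<^sub>n\<rangle>\<close> and \<open>r = |z|\<close>, Cauchy--Schwarz gives
  \<open>|\<Sum> (n + 1)\<^sup>1\<^sup>/\<^sup>2 z\<^sup>n f\<^sub>n|\<^sup>2 \<le> (1 - r)\<^sup>-\<^sup>1 \<Sum> (n + 1) r\<^sup>n |f\<^sub>n|\<^sup>2\<close>, and each
  summand on the right is integrated over the disc using the orthogonality of the monomials, so
  the symbol lies in \<open>BMOA_C\<close>. The symbol with adjoint coefficients, applied to the constant
  function \<open>e\<^sub>0\<close>, yields \<open>\<Sum> \<pi> / (n + 2) = \<infinity>\<close>. The same divergence shows that the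
  Hankel operator is unbounded: test it on the normalised sums
  \<open>\<Sum>\<^sub>n (n + 1)\<^sup>-\<^sup>1\<^sup>/\<^sup>2 z\<^sup>n e\<^sub>n\<close> and look at the constant coefficient.
\<close>

section \<open>Complex Hilbert spaces and rank-one operators\<close>

lemma scaleR_scaleC_swap: "r *\<^sub>R (c *\<^sub>C x) = c *\<^sub>C (r *\<^sub>R (x :: 'a::complex_vector))"
  by (simp flip: scaleC_of_real add: scaleC_scaleC mult.commute)

text \<open>Makes the limit, sum and derivative rules for bounded bilinear maps available for
  complex scaling.\<close>

lemma bounded_bilinear_scaleC:
  "bounded_bilinear (scaleC :: complex \<Rightarrow> 'a::complex_normed_vector \<Rightarrow> 'a)"
proof
  show "\<exists>K. \<forall>c (x :: 'a). norm (c *\<^sub>C x) \<le> norm c * norm x * K"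
    by (intro exI[of _ 1]) (simp add: norm_scaleC)
  show "(r *\<^sub>R c) *\<^sub>C x = r *\<^sub>R c *\<^sub>C x" for r c and x :: 'a
    by (simp flip: scaleC_of_real add: scaleC_scaleC scaleR_conv_of_real)
qed (simp_all add: scaleC_add_left scaleC_add_right scaleR_scaleC_swap)

interpretation scaleC: bounded_bilinear "scaleC :: complex \<Rightarrow> 'a::complex_normed_vector \<Rightarrow> 'a"
  by (rule bounded_bilinear_scaleC)

lemma scaleC_1 [simp]: "1 *\<^sub>C x = (x :: 'a::complex_vector)"
  using scaleC_of_real[of 1 x] by simp

lemma cinner_add_right: "cinner x (y + z) = cinner x y + cinner x (z :: 'a::complex_inner)"
  by (metis cinner_add_left cinner_commute complex_cnj_add)

lemma cinner_scaleC_right: "cinner x (c *\<^sub>C y) = cnj c * cinner x (y :: 'a::complex_inner)"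
  by (metis cinner_scaleC_left cinner_commute complex_cnj_mult)

lemma cinner_zero [simp]: "cinner 0 x = 0" "cinner x 0 = (0 :: complex)" for x :: "'a::complex_inner"
  using cinner_scaleC_left[of 0 0 x] cinner_scaleC_right[of x 0 0] by simp_all

lemma cinner_minus_left: "cinner (- x) y = - cinner x (y :: 'a::complex_inner)"
  using cinner_add_left[of "- x" x y] by (simp add: add_eq_0_iff2)

lemma cinner_diff_left: "cinner (x - y) z = cinner x z - cinner y (z :: 'a::complex_inner)"
  using cinner_add_left[of x "- y" z] by (simp add: cinner_minus_left)

lemma cinner_scaleR_left: "cinner (r *\<^sub>R x) y = r *\<^sub>R cinner x (y :: 'a::complex_inner)"
  by (simp flip: scaleC_of_real add: cinner_scaleC_left scaleR_conv_of_real)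

lemma cinner_scaleR_right: "cinner x (r *\<^sub>R y) = r *\<^sub>R cinner x (y :: 'a::complex_inner)"
  by (simp flip: scaleC_of_real add: cinner_scaleC_right scaleR_conv_of_real)

lemma cinner_sum_left: "cinner (sum f A) y = (\<Sum>i\<in>A. cinner (f i) (y :: 'a::complex_inner))"
  by (induction A rule: infinite_finite_induct) (simp_all add: cinner_add_left)

text \<open>With \<open>a = <y, y>\<close> and \<open>b = <x, y>\<close>, the squared norm of
  \<open>a x - b y\<close> expands to \<open>a (a |x|^2 - |b|^2)\<close>. It is nonnegative, and
  \<open>a\<close> may be cancelled when \<open>y\<close> is nonzero.\<close>

lemma cinner_cauchy_schwarz: "cmod (cinner x y) \<le> norm x * norm (y :: 'a::complex_inner)"
proof (cases "y = 0")
  case False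
  define N where "N = (norm y)\<^sup>2"
  define a where "a = complex_of_real N"
  define b where "b = cinner x y"
  define X where "X = (norm x)\<^sup>2"
  have b': "cinner y x = cnj b" unfolding b_def by (rule cinner_commute)
  have yy: "cinner y y = a" unfolding a_def N_def by (rule cinner_self)
  have xx: "cinner x x = complex_of_real X" unfolding X_def by (rule cinner_self)
  have bb: "b * cnj b = complex_of_real ((cmod b)\<^sup>2)"
    by (metis complex_norm_square)
  have "cinner (a *\<^sub>C x + (- b) *\<^sub>C y) (a *\<^sub>C x + (- b) *\<^sub>C y)
      = a * (a * complex_of_real X - b * cnj b)"
    by (simp only: cinner_add_left cinner_add_right cinner_scaleC_left cinner_scaleC_right b' yy xx
        b_def[symmetric]) (simp add: a_def algebra_simps)
  also have "\<dots> = complex_of_real (N * (N * X - (cmod b)\<^sup>2))"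
    unfolding bb a_def by simp
  finally have "(norm (a *\<^sub>C x + (- b) *\<^sub>C y))\<^sup>2 = N * (N * X - (cmod b)\<^sup>2)"
    by (simp only: cinner_self of_real_eq_iff)
  then have "(norm (a *\<^sub>C x + (- b) *\<^sub>C y))\<^sup>2
      = (norm y)\<^sup>2 * ((norm y)\<^sup>2 * (norm x)\<^sup>2 - (cmod b)\<^sup>2)"
    unfolding N_def X_def .
  then have "0 \<le> (norm y)\<^sup>2 * ((norm y)\<^sup>2 * (norm x)\<^sup>2 - (cmod b)\<^sup>2)"
    by (metis zero_le_power2)
  then have "0 \<le> (norm y)\<^sup>2 * (norm x)\<^sup>2 - (cmod b)\<^sup>2"
    using False by (simp add: zero_le_mult_iff)
  then have "(cmod b)\<^sup>2 \<le> (norm x * norm y)\<^sup>2"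
    by (simp add: power_mult_distrib mult.commute)
  then show ?thesis unfolding b_def by (rule power2_le_imp_le) simp
qed simp

lemma bounded_linear_cinner_left: "bounded_linear (\<lambda>x. cinner x (y :: 'a::complex_inner))"
  by (rule bounded_linear_intro[of _ "norm y"])
    (simp_all add: cinner_add_left cinner_scaleR_left cinner_cauchy_schwarz)

lemma bounded_linear_cinner_right: "bounded_linear (\<lambda>y. cinner x (y :: 'a::complex_inner))"
  by (rule bounded_linear_intro[of _ "norm x"])
    (simp_all add: cinner_add_right cinner_scaleR_right cinner_cauchy_schwarz mult.commute[of "norm _" "norm x"])

lemma cinner_eqI:
  assumes "\<And>z. cinner x z = cinner y z"
  shows "x = (y :: 'a::complex_inner)"
proof -
  have "cinner (x - y) (x - y) = 0"
    by (simp add: cinner_diff_left assms)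
  then show ?thesis by (simp add: cinner_self)
qed

section \<open>Orthonormal sequences: existence and Bessel's inequality\<close>

definition orthonormal_seq :: "(nat \<Rightarrow> 'a::complex_inner) \<Rightarrow> bool" where
  "orthonormal_seq e \<longleftrightarrow> (\<forall>m n. cinner (e m) (e n) = (if m = n then 1 else 0))"

lemma orthonormal_seqD: "orthonormal_seq e \<Longrightarrow> cinner (e m) (e n) = (if m = n then 1 else 0)"
  by (simp add: orthonormal_seq_def)

lemma norm_orthonormal_seq:
  assumes "orthonormal_seq e"
  shows "norm (e n) = 1"
proof -
  have "complex_of_real ((norm (e n))\<^sup>2) = complex_of_real 1"
    using orthonormal_seqD[OF assms, of n n] by (simp only: cinner_self of_real_1 if_True simp_thms)
  then have "(norm (e n))\<^sup>2 = 1" by (simp only: of_real_eq_iff)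
  then show ?thesis by (simp add: power2_eq_1_iff) (smt (verit) norm_ge_zero)
qed

text \<open>One Gram-Schmidt step: the finite set \<open>B\<close> does not span, so a vector
  outside its span minus its projection onto the span is nonzero, orthogonal to \<open>B\<close>,
  and can be normalised.\<close>

lemma ex_unit_orthogonal:
  fixes B :: "'a::complex_inner set"
  assumes "infinite_dimensional TYPE('a)" and "finite B"
    and B: "\<And>b c. b \<in> B \<Longrightarrow> c \<in> B \<Longrightarrow> cinner b c = (if b = c then 1 else 0)"
  shows "\<exists>y. norm y = 1 \<and> (\<forall>b\<in>B. cinner y b = 0)"
proof -
  obtain x where x: "x \<notin> complex_vector.span B"
    using assms(1,2) unfolding infinite_dimensional_def by blast
  define p where "p = (\<Sum>b\<in>B. cinner x b *\<^sub>C b)"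
  have "p \<in> complex_vector.span B"
    unfolding p_def
    by (intro complex_vector.span_sum complex_vector.span_scale complex_vector.span_base)
  then have "x - p \<noteq> 0" using x by auto
  have "cinner (x - p) c = 0" if c: "c \<in> B" for c
  proof -
    have "cinner p c = (\<Sum>b\<in>B. if b = c then cinner x b else 0)"
      unfolding p_def cinner_sum_left
      by (intro sum.cong) (simp_all add: cinner_scaleC_left B c)
    then show ?thesis using c \<open>finite B\<close> by (simp add: cinner_diff_left)
  qed
  then show ?thesis
    using \<open>x - p \<noteq> 0\<close>
    by (intro exI[of _ "(1 / norm (x - p)) *\<^sub>R (x - p)"]) (simp add: cinner_scaleR_left)
qed

text \<open>Dependent choice runs on finite orthonormal sets, since the next vector depends on all
  earlier ones. Each set gains exactly one vector, and \<open>e n\<close> is the one added at stage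
  \<open>n\<close>.\<close>

lemma ex_orthonormal_seq:
  assumes "infinite_dimensional TYPE('a::complex_inner)"
  shows "\<exists>e :: nat \<Rightarrow> 'a. orthonormal_seq e"
proof -
  define P where "P B \<longleftrightarrow> finite B \<and>
    (\<forall>b\<in>B. \<forall>c\<in>B. cinner b c = (if b = c then 1 else 0))" for B :: "'a set"
  have "\<exists>f :: nat \<Rightarrow> 'a set. \<forall>n. P (f n) \<and> (\<exists>y. y \<notin> f n \<and> f (Suc n) = insert y (f n))"
  proof (rule dependent_nat_choice)
    show "\<exists>B :: 'a set. P B" by (rule exI[of _ "{}"]) (simp add: P_def)
    fix B :: "'a set" and n :: nat
    assume B: "P B"
    then obtain y where y: "norm y = 1" "\<forall>b\<in>B. cinner y b = 0"
      using ex_unit_orthogonal[OF assms, of B] unfolding P_def by blast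
    then have "cinner y y = 1" by (simp add: cinner_self)
    moreover have "\<forall>b\<in>B. cinner b y = 0"
      using y(2) by (metis cinner_commute complex_cnj_zero)
    ultimately have "y \<notin> B" "P (insert y B)"
      using B y unfolding P_def by auto
    then show "\<exists>C. P C \<and> (\<exists>y. y \<notin> B \<and> C = insert y B)" by blast
  qed
  then obtain f where f: "\<And>n. P (f n)" "\<And>n. \<exists>y. y \<notin> f n \<and> f (Suc n) = insert y (f n)"
    by blast
  from f(2) obtain e where e: "\<And>n. e n \<notin> f n" "\<And>n. f (Suc n) = insert (e n) (f n)"
    by metis
  have mono: "f m \<subseteq> f n" if "m \<le> n" for m n
    using that by (rule lift_Suc_mono_le[rotated]) (auto simp: e(2))
  have mem: "e m \<in> f n" if "m < n" for m n
    using mono[of "Suc m" n] that e(2)[of m] by auto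
  have ne: "e m \<noteq> e n" if "m < n" for m n
    using mem[OF that] e(1)[of n] by auto
  have "cinner (e m) (e n) = (if m = n then 1 else 0)" for m n
  proof -
    \<comment> \<open>Any two vectors of the sequence lie in a common stage, whose orthonormality
      applies to the pair.\<close>
    have "e m \<in> f (Suc (max m n))" "e n \<in> f (Suc (max m n))"
      by (auto intro!: mem)
    then have "cinner (e m) (e n) = (if e m = e n then 1 else 0)"
      using f(1)[of "Suc (max m n)"] unfolding P_def by blast
    moreover have "e m = e n \<longleftrightarrow> m = n"
      using ne by (metis linorder_neqE_nat)
    ultimately show ?thesis by simp
  qed
  then show ?thesis unfolding orthonormal_seq_def by blast
qed

text \<open>The vector \<open>p\<close> is the projection of \<open>x\<close> onto the span of the
  first \<open>N\<close> vectors. Its squared norm is the sum on the left and also equals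
  \<open><x, p>\<close>, so Cauchy-Schwarz yields \<open>norm p \<le> norm x\<close>.\<close>

lemma bessel_sum:
  fixes x :: "'a::complex_inner"
  assumes e: "orthonormal_seq e"
  shows "(\<Sum>n<N. (cmod (cinner x (e n)))\<^sup>2) \<le> (norm x)\<^sup>2"
proof -
  define p where "p = (\<Sum>n<N. cinner x (e n) *\<^sub>C e n)"
  have pe: "cinner p (e m) = cinner x (e m)" if "m < N" for m
  proof -
    have "cinner p (e m) = (\<Sum>n<N. if n = m then cinner x (e n) else 0)"
      unfolding p_def cinner_sum_left
      by (intro sum.cong) (simp_all add: cinner_scaleC_left orthonormal_seqD[OF e])
    then show ?thesis using that by simp
  qed
  have yp: "cinner y p = (\<Sum>n<N. cnj (cinner x (e n)) * cinner y (e n))" for y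
  proof -
    have "cinner y (sum g A) = (\<Sum>n\<in>A. cinner y (g n))" for g :: "nat \<Rightarrow> 'a" and A
      using bounded_linear.linear[OF bounded_linear_cinner_right] by (rule linear_sum)
    then show ?thesis by (simp add: p_def cinner_scaleC_right)
  qed
  have "cinner (x - p) p = 0"
    by (simp add: cinner_diff_left yp pe)
  then have "cinner x p = cinner p p" by (simp add: cinner_diff_left)
  then have "complex_of_real ((norm p)\<^sup>2) = cinner x p" by (simp add: cinner_self)
  also have "\<dots> = complex_of_real (\<Sum>n<N. (cmod (cinner x (e n)))\<^sup>2)"
    by (simp add: yp complex_norm_square mult.commute del: of_real_power)
  finally have S: "(norm p)\<^sup>2 = (\<Sum>n<N. (cmod (cinner x (e n)))\<^sup>2)"
    by (simp only: of_real_eq_iff)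
  have "(norm p)\<^sup>2 = cmod (cinner x p)"
    using \<open>complex_of_real ((norm p)\<^sup>2) = cinner x p\<close> by (metis norm_of_real abs_of_nonneg zero_le_power2)
  also have "\<dots> \<le> norm x * norm p" by (rule cinner_cauchy_schwarz)
  finally have "norm p \<le> norm x"
    by (cases "p = 0") (auto simp: power2_eq_square)
  then show ?thesis unfolding S[symmetric] by (intro power_mono) auto
qed

section \<open>Bounded operators, adjoints and rank-one operators\<close>

lemma norm_cblinfun_apply: "norm (cblinfun_apply A x) \<le> norm A * norm x"
  by transfer (rule norm_blinfun)

lemma bounded_linear_cblinfun_apply_left: "bounded_linear (\<lambda>A. cblinfun_apply A x)"
proof (rule bounded_linear_intro)
  show "cblinfun_apply (A + B) x = cblinfun_apply A x + cblinfun_apply B x" for A B :: "('a, 'b) cblinfun"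
    by transfer (rule blinfun.add_left)
  show "cblinfun_apply (r *\<^sub>R A) x = r *\<^sub>R cblinfun_apply A x" for r and A :: "('a, 'b) cblinfun"
    by transfer (rule blinfun.scaleR_left)
  show "norm (cblinfun_apply A x) \<le> norm A * norm x" for A :: "('a, 'b) cblinfun"
    by (rule norm_cblinfun_apply)
qed

lemma cblinfun_apply_scaleC: "cblinfun_apply (c *\<^sub>C A) x = c *\<^sub>C cblinfun_apply A x"
  by transfer (simp add: bounded_linear_Blinfun_apply bounded_linear_scaleC_right)

lemma cblinfun_apply_scaleR: "cblinfun_apply (r *\<^sub>R A) x = r *\<^sub>R cblinfun_apply A x"
  by transfer (rule blinfun.scaleR_left)

lemma cblinfun_eqI: "(\<And>x. cblinfun_apply A x = cblinfun_apply B x) \<Longrightarrow> A = B"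
  by transfer (rule blinfun_eqI)

text \<open>The adjoint identity determines an operator pointwise through its inner products, so
  exhibiting one operator with this property evaluates the definite description.\<close>

lemma cadjoint_eqI:
  assumes "\<And>x y. cinner (cblinfun_apply B x) y = cinner x (cblinfun_apply A y)"
  shows "cadjoint A = B"
  unfolding cadjoint_def
proof (rule the_equality)
  fix C assume C: "\<forall>x y. cinner (cblinfun_apply C x) y = cinner x (cblinfun_apply A y)"
  show "C = B"
  proof (intro cblinfun_eqI cinner_eqI)
    show "cinner (cblinfun_apply C x) y = cinner (cblinfun_apply B x) y" for x y
      using C assms by metis
  qed
qed (use assms in blast)

lemma bounded_linear_rank_one:
  "bounded_linear (\<lambda>x. cinner x v *\<^sub>C (w :: 'a::complex_inner))"
  by (rule bounded_linear_compose[OF scaleC.bounded_linear_left bounded_linear_cinner_left])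

text \<open>In Dirac notation this is \<open>|w><v|\<close>: the range vector comes first, the
  vector of the functional second.\<close>

lift_definition rank_one :: "'a::complex_inner \<Rightarrow> 'a \<Rightarrow> ('a, 'a) cblinfun"
  is "\<lambda>w v. Blinfun (\<lambda>x. cinner x v *\<^sub>C w)"
  by (simp add: bounded_linear_Blinfun_apply[OF bounded_linear_rank_one] cinner_scaleC_left scaleC_scaleC)

lemma rank_one_apply [simp]: "cblinfun_apply (rank_one w v) x = cinner x v *\<^sub>C w"
  by transfer (simp add: bounded_linear_Blinfun_apply[OF bounded_linear_rank_one])

lemma norm_rank_one_le: "norm (rank_one w v) \<le> norm w * norm v"
proof (transfer, rule norm_blinfun_bound)
  fix w v x :: 'a
  have "norm (blinfun_apply (Blinfun (\<lambda>x. cinner x v *\<^sub>C w)) x) = cmod (cinner x v) * norm w"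
    by (simp only: bounded_linear_Blinfun_apply[OF bounded_linear_rank_one] norm_scaleC)
  also have "\<dots> \<le> norm x * norm v * norm w"
    by (intro mult_right_mono cinner_cauchy_schwarz) simp
  finally show "norm (blinfun_apply (Blinfun (\<lambda>x. cinner x v *\<^sub>C w)) x) \<le> norm w * norm v * norm x"
    by (simp only: mult_ac)
qed simp

section \<open>Vector-valued power series\<close>

lemma complex_deriv_eqI:
  assumes "has_complex_derivative f D z"
  shows "complex_deriv f z = D"
  unfolding complex_deriv_def
proof (rule the_equality)
  fix E assume "has_complex_derivative f E z"
  then have "(\<lambda>h. h *\<^sub>C E) = (\<lambda>h. h *\<^sub>C D)"
    using assms unfolding has_complex_derivative_def by (rule has_derivative_unique)
  from fun_cong[OF this, of 1] show "E = D" by simp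
qed (rule assms)

lemma has_complex_derivative_transform:
  assumes "has_complex_derivative f D z" "open S" "z \<in> S" "\<And>w. w \<in> S \<Longrightarrow> f w = g w"
  shows "has_complex_derivative g D z"
  using assms has_derivative_transform_within_open[of f "\<lambda>h. h *\<^sub>C D" z UNIV S g]
  unfolding has_complex_derivative_def by auto

text \<open>Termwise differentiation does not shrink the disc of convergence. The scalar version is
  applied to the real power series with coefficients \<open>norm (a n)\<close>.\<close>

lemma summable_powser_deriv:
  fixes a :: "nat \<Rightarrow> 'a::real_normed_vector"
  assumes a: "\<And>s. 0 \<le> s \<Longrightarrow> s < r \<Longrightarrow> summable (\<lambda>n. norm (a n) * s ^ n)"
    and s: "0 \<le> s" "s < r"
  shows "summable (\<lambda>n. norm (real (Suc n) *\<^sub>R a (Suc n)) * s ^ n)"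
proof -
  have "summable (\<lambda>n. diffs (\<lambda>n. norm (a n)) n * s ^ n)"
  proof (rule termdiff_converges)
    show "norm s < r" using s by simp
    fix x :: real assume "norm x < r"
    then have "summable (\<lambda>n. \<bar>norm (a n) * x ^ n\<bar>)"
      using a[of "\<bar>x\<bar>"] by (simp add: abs_mult power_abs)
    then show "summable (\<lambda>n. norm (a n) * x ^ n)" by (rule summable_rabs_cancel)
  qed
  then show ?thesis by (simp add: diffs_def del: of_nat_Suc)
qed

lemma powser_sums_at_0: "(\<lambda>n. 0 ^ n *\<^sub>C a n) sums (a 0 :: 'a::complex_normed_vector)"
proof -
  have "(\<lambda>n. 0 ^ n *\<^sub>C a n) = (\<lambda>n. if n = 0 then a n else 0)"
    by (auto simp: fun_eq_iff power_0_left)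
  then show ?thesis using sums_single[of 0 a] by simp
qed

text \<open>On a disc of radius \<open>s\<close> strictly between \<open>cmod z\<close> and
  \<open>r\<close> the differentiated series converges uniformly by the M-test, which permits
  termwise differentiation.\<close>

lemma has_complex_derivative_powser:
  fixes a :: "nat \<Rightarrow> 'a::cbanach"
  assumes a: "\<And>s. 0 \<le> s \<Longrightarrow> s < r \<Longrightarrow> summable (\<lambda>n. norm (a n) * s ^ n)"
    and z: "z \<in> ball 0 r"
  shows "has_complex_derivative (\<lambda>z. \<Sum>n. z ^ n *\<^sub>C a n)
    (\<Sum>n. z ^ n *\<^sub>C (real (Suc n) *\<^sub>R a (Suc n))) z"
proof -
  obtain s where s: "cmod z < s" "s < r" using z dense by auto
  have s0: "0 \<le> s" using s norm_ge_zero[of z] by linarith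
  \<comment> \<open>For \<open>n = 0\<close> the truncated exponent \<open>n - 1\<close> does no
    harm, because the factor \<open>of_nat n\<close> vanishes. \<open>D_eq\<close> drops this term
    and shifts the index.\<close>
  define t where "t n x = (of_nat n * x ^ (n - 1)) *\<^sub>C a n" for n and x :: complex
  define D where "D x = (\<Sum>n. t n x)" for x
  have tb: "norm (t n x) \<le> real n * s ^ (n - 1) * norm (a n)" if "x \<in> ball 0 s" for n x
    unfolding t_def norm_scaleC norm_mult norm_power
    using that by (intro mult_right_mono mult_mono power_mono) auto
  have sb: "summable (\<lambda>n. real n * s ^ (n - 1) * norm (a n))"
    using summable_powser_deriv[OF a s0 s(2)]
    by (subst summable_Suc_iff[symmetric]) (simp add: mult_ac)
  have unif: "uniform_limit (ball 0 s) (\<lambda>n x. \<Sum>i<n. t i x) D sequentially"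
    unfolding D_def by (rule Weierstrass_m_test[OF tb sb])
  have D_eq: "D z = (\<Sum>n. z ^ n *\<^sub>C (real (Suc n) *\<^sub>R a (Suc n)))"
  proof -
    have "summable (\<lambda>n. t n z)"
      using s by (intro summable_comparison_test'[OF sb] tb) auto
    from suminf_split_head[OF this] have "D z = (\<Sum>n. t (Suc n) z)"
      by (simp add: D_def t_def)
    moreover have "t (Suc n) z = z ^ n *\<^sub>C (real (Suc n) *\<^sub>R a (Suc n))" for n
      unfolding t_def by (simp add: scaleC_scaleC mult.commute flip: scaleC_of_real)
    ultimately show ?thesis by simp
  qed
  have "\<exists>g. \<forall>x\<in>ball 0 s. (\<lambda>n. x ^ n *\<^sub>C a n) sums g x \<and>
      (g has_derivative (\<lambda>h. h *\<^sub>C D x)) (at x within ball 0 s)"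
  proof (rule has_derivative_series)
    show "convex (ball (0::complex) s)" by simp
    show "((\<lambda>x. x ^ n *\<^sub>C a n) has_derivative (\<lambda>h. h *\<^sub>C t n x)) (at x within ball 0 s)" for n x
    proof -
      have "((\<lambda>x. x ^ n) has_derivative (\<lambda>h. of_nat n * x ^ (n - 1) * h)) (at x within ball 0 s)"
        using DERIV_power[OF DERIV_ident, of n x "ball 0 s"]
        by (simp add: has_field_derivative_def)
      from bounded_linear.has_derivative[OF scaleC.bounded_linear_left this]
      show ?thesis by (simp add: t_def scaleC_scaleC mult.commute)
    qed
    fix \<epsilon> :: real assume "\<epsilon> > 0"
    from uniform_limitD[OF unif this]
    show "\<forall>\<^sub>F n in sequentially. \<forall>x\<in>ball 0 s. \<forall>h.
        norm ((\<Sum>i<n. h *\<^sub>C t i x) - h *\<^sub>C D x) \<le> \<epsilon> * norm h"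
    proof eventually_elim
      case (elim n)
      show ?case
      proof (intro ballI allI)
        fix x h :: complex assume "x \<in> ball 0 s"
        then have "norm ((\<Sum>i<n. t i x) - D x) \<le> \<epsilon>"
          using elim by (force simp: dist_norm)
        then have "cmod h * norm ((\<Sum>i<n. t i x) - D x) \<le> cmod h * \<epsilon>"
          by (rule mult_left_mono) simp
        then show "norm ((\<Sum>i<n. h *\<^sub>C t i x) - h *\<^sub>C D x) \<le> \<epsilon> * norm h"
          by (simp add: mult.commute norm_scaleC flip: scaleC.sum_right scaleC.diff_right)
      qed
    qed
  next
    show "0 \<in> ball (0::complex) s" using s norm_ge_zero[of z] by (simp del: norm_ge_zero)
    show "(\<lambda>n. 0 ^ n *\<^sub>C a n) sums a 0" by (rule powser_sums_at_0)
  qed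
  then obtain g where g: "\<And>x. x \<in> ball 0 s \<Longrightarrow> (\<lambda>n. x ^ n *\<^sub>C a n) sums g x"
    "\<And>x. x \<in> ball 0 s \<Longrightarrow> (g has_derivative (\<lambda>h. h *\<^sub>C D x)) (at x within ball 0 s)"
    by blast
  have zs: "z \<in> ball 0 s" using s by simp
  then have "has_complex_derivative g (D z) z"
    using g(2)[OF zs] at_within_open[OF zs] by (simp add: has_complex_derivative_def)
  then have "has_complex_derivative (\<lambda>z. \<Sum>n. z ^ n *\<^sub>C a n) (D z) z"
    by (rule has_complex_derivative_transform[of _ _ _ "ball 0 s"]) (use zs g(1) in \<open>auto dest: sums_unique\<close>)
  then show ?thesis by (simp only: D_eq)
qed

text \<open>Only agreement of \<open>f\<close> with the series on the disc is assumed, so the result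
  also applies to functions known there alone, such as the adjoint symbol.\<close>

lemma
  fixes f :: "complex \<Rightarrow> 'a::cbanach"
  assumes a: "\<And>s. 0 \<le> s \<Longrightarrow> s < r \<Longrightarrow> summable (\<lambda>n. norm (a n) * s ^ n)"
    and f: "\<And>z. z \<in> ball 0 r \<Longrightarrow> f z = (\<Sum>n. z ^ n *\<^sub>C a n)"
  shows analytic_in_powser: "analytic_in f (ball 0 r)"
    and taylor_coeff_powser: "0 < r \<Longrightarrow> taylor_coeff f n = a n"
proof -
  show "analytic_in f (ball 0 r)"
    unfolding analytic_in_def
  proof (intro ballI exI)
    fix z :: complex assume z: "z \<in> ball 0 r"
    from has_complex_derivative_powser[OF a z] open_ball z f[symmetric]
    show "has_complex_derivative f (\<Sum>n. z ^ n *\<^sub>C (real (Suc n) *\<^sub>R a (Suc n))) z"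
      by (rule has_complex_derivative_transform)
  qed
  \<comment> \<open>The coefficients of the \<open>n\<close>-th derivative. Their constant term is
    \<open>fact n\<close> times \<open>a n\<close>, which the normalisation in
    \<open>taylor_coeff\<close> undoes.\<close>
  define b where "b n k = (fact (n + k) / fact k) *\<^sub>R a (n + k)" for n k
  have b_Suc: "real (Suc k) *\<^sub>R b n (Suc k) = b (Suc n) k" for n k
  proof -
    have "real (Suc k) * (fact (n + Suc k) / fact (Suc k)) = (fact (Suc n + k) / fact k :: real)"
      unfolding fact_Suc[of k] by (simp del: of_nat_Suc fact_Suc)
    then show ?thesis by (simp add: b_def del: of_nat_Suc fact_Suc)
  qed
  have b: "summable (\<lambda>k. norm (b n k) * s ^ k)" if "0 \<le> s" "s < r" for n s
    using that
  proof (induction n arbitrary: s)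
    case 0
    then show ?case using a by (simp add: b_def)
  next
    case (Suc n)
    then show ?case
      using summable_powser_deriv[of r "b n" s] by (simp only: b_Suc)
  qed
  have iter: "(complex_deriv ^^ n) f z = (\<Sum>k. z ^ k *\<^sub>C b n k)" if "z \<in> ball 0 r" for n z
    using that
  proof (induction n arbitrary: z)
    case 0
    then show ?case by (simp add: b_def f)
  next
    case (Suc n)
    have "has_complex_derivative (\<lambda>z. \<Sum>k. z ^ k *\<^sub>C b n k) (\<Sum>k. z ^ k *\<^sub>C b (Suc n) k) z"
      using has_complex_derivative_powser[OF b Suc.prems, of n] by (simp only: b_Suc)
    then have "has_complex_derivative ((complex_deriv ^^ n) f) (\<Sum>k. z ^ k *\<^sub>C b (Suc n) k) z"
      using open_ball Suc.prems Suc.IH[symmetric] by (rule has_complex_derivative_transform)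
    from complex_deriv_eqI[OF this] show ?case by simp
  qed
  assume "0 < r"
  then have "(complex_deriv ^^ n) f 0 = b n 0"
    using powser_sums_at_0[of "b n"] iter[of 0 n] \<open>0 < r\<close> by (simp add: sums_iff)
  then show "taylor_coeff f n = a n"
    by (simp add: taylor_coeff_def b_def)
qed

section \<open>Scalar components of vector-valued analytic functions\<close>

lemma has_field_derivative_cinner:
  assumes "has_complex_derivative f D z"
  shows "((\<lambda>z. cinner (f z) e) has_field_derivative cinner D e) (at z)"
  using bounded_linear.has_derivative[OF bounded_linear_cinner_left
      assms[unfolded has_complex_derivative_def], of e]
  by (simp add: has_field_derivative_def cinner_scaleC_left mult_commute_abs)

text \<open>Complex differentiability alone must yield the Taylor expansion. The vectors
  \<open>a n\<close> are defined by Cauchy's integral formula over a circle. Their inner products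
  with any \<open>e\<close> are the Taylor coefficients of the scalar function, so near 0 the
  function \<open>f\<close> is the power series with coefficients \<open>a n\<close>, and these are
  its Taylor coefficients.\<close>

lemma
  fixes f :: "complex \<Rightarrow> 'a::chilbert_space"
  assumes f: "f \<in> Hol"
  shows holomorphic_cinner: "(\<lambda>z. cinner (f z) e) holomorphic_on ball 0 1"
    and cinner_taylor_coeff:
      "cinner (taylor_coeff f n) e = (deriv ^^ n) (\<lambda>z. cinner (f z) e) 0 / fact n"
proof -
  have an: "\<exists>D. has_complex_derivative f D z" if "z \<in> ball 0 1" for z
    using f that unfolding Hol_def analytic_in_def by blast
  have hol: "(\<lambda>z. cinner (f z) e) holomorphic_on ball 0 1" for e
  proof (rule holomorphic_onI, rule field_differentiable_at_within)
    fix z :: complex assume "z \<in> ball 0 1"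
    then obtain D where "has_complex_derivative f D z" using an by blast
    then show "(\<lambda>z. cinner (f z) e) field_differentiable at z"
      unfolding field_differentiable_def by (intro exI) (rule has_field_derivative_cinner)
  qed
  then show "(\<lambda>z. cinner (f z) e) holomorphic_on ball 0 1" .
  have contf: "continuous_on (ball 0 1) f"
  proof (intro continuous_at_imp_continuous_on ballI)
    fix z :: complex assume "z \<in> ball 0 1"
    then obtain D where "has_complex_derivative f D z" using an by blast
    then show "isCont f z"
      unfolding has_complex_derivative_def by (rule has_derivative_continuous)
  qed
  define \<gamma> where "\<gamma> = circlepath (0::complex) (1/2)"
  have \<gamma>_eq: "\<gamma> t = 1/2 * exp (2 * of_real pi * \<i> * of_real t)" for t
    by (simp add: \<gamma>_def circlepath)
  have vd: "vector_derivative \<gamma> (at t) = 2 * pi * \<i> * \<gamma> t" for t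
    unfolding \<gamma>_def vector_derivative_circlepath by (simp add: circlepath)
  have \<gamma>: "cmod (\<gamma> t) = 1/2" for t
    by (simp add: \<gamma>_eq norm_mult)
  have \<gamma>0: "\<gamma> t \<noteq> 0" for t using \<gamma>[of t] by auto
  have cont\<gamma>: "continuous_on {0..1} \<gamma>"
    unfolding \<gamma>_eq[abs_def] by (intro continuous_intros)
  \<comment> \<open>Along the circle, \<open>du / u^(n+1)\<close> becomes
    \<open>2 pi i u^(-n) dt\<close>. Hence \<open>F n\<close> is the integrand of Cauchy's formula
    for the \<open>n\<close>-th coefficient with the factor \<open>2 pi i\<close> divided
    out.\<close>
  define F where "F n t = inverse (\<gamma> t) ^ n *\<^sub>C f (\<gamma> t)" for n t
  have contF: "continuous_on {0..1} (F n)" for n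
    unfolding F_def
    by (intro scaleC.continuous_on continuous_intros cont\<gamma> continuous_on_compose2[OF contf cont\<gamma>])
      (auto simp: \<gamma> \<gamma>0)
  define a where "a n = integral {0..1} (F n)" for n
  have "compact (f ` cball 0 (1/2))"
    by (intro compact_continuous_image continuous_on_subset[OF contf]) auto
  then obtain M where M: "\<And>z. z \<in> cball 0 (1/2) \<Longrightarrow> norm (f z) \<le> M"
    using compact_imp_bounded bounded_iff by (metis imageI)
  have an_le: "norm (a n) \<le> 2 ^ n * M" for n
  proof -
    have "norm (F n t) \<le> 2 ^ n * M" for t
      using M[of "\<gamma> t"] by (simp add: F_def norm_scaleC norm_power norm_inverse \<gamma> mult_left_mono)
    then show ?thesis
      using integral_bound[OF _ contF, of n "2 ^ n * M"] by (simp add: a_def)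
  qed
  have a: "cinner (a n) e = (deriv ^^ n) (\<lambda>z. cinner (f z) e) 0 / fact n" for n e
  proof -
    let ?g = "\<lambda>z. cinner (f z) e"
    have "((\<lambda>u. ?g u / (u - 0) ^ Suc n) has_contour_integral
        (2 * pi * \<i> / fact n * (deriv ^^ n) ?g 0)) \<gamma>"
      unfolding \<gamma>_def
      by (intro Cauchy_has_contour_integral_higher_derivative_circlepath
          holomorphic_on_imp_continuous_on holomorphic_on_subset[OF hol]) auto
    then have "((\<lambda>t. ?g (\<gamma> t) / \<gamma> t ^ Suc n * (2 * pi * \<i> * \<gamma> t)) has_integral
        (2 * pi * \<i> / fact n * (deriv ^^ n) ?g 0)) {0..1}"
      unfolding has_contour_integral by (simp only: vd diff_zero)
    from has_integral_mult_right[OF this, of "1 / (2 * pi * \<i>)"]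
    have "((\<lambda>t. cinner (F n t) e) has_integral (deriv ^^ n) ?g 0 / fact n) {0..1}"
      by (simp add: F_def cinner_scaleC_left \<gamma>0 field_simps)
    moreover have "((\<lambda>t. cinner (F n t) e) has_integral cinner (a n) e) {0..1}"
      using has_integral_linear[OF integrable_integral[OF integrable_continuous_real[OF contF[of n]]]
          bounded_linear_cinner_left[of e]]
      by (simp add: a_def comp_def)
    ultimately show ?thesis by (rule has_integral_unique[symmetric])
  qed
  \<comment> \<open>The bound \<open>2 ^ n * M\<close> on the coefficients makes the series converge
    on the disc of radius 1/2, which suffices to read off Taylor coefficients at 0.\<close>
  have summ: "summable (\<lambda>n. norm (a n) * s ^ n)" if "0 \<le> s" "s < 1/2" for s
  proof (rule summable_comparison_test')
    show "summable (\<lambda>n. M * (2 * s) ^ n)"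
      using that by (intro summable_mult summable_geometric) auto
    show "norm (norm (a n) * s ^ n) \<le> M * (2 * s) ^ n" if "n \<ge> 0" for n
      using mult_right_mono[OF an_le[of n], of "s ^ n"] \<open>0 \<le> s\<close>
      by (simp add: power_mult_distrib mult_ac)
  qed
  have "f z = (\<Sum>n. z ^ n *\<^sub>C a n)" if z: "z \<in> ball 0 (1/2)" for z
  proof (rule cinner_eqI)
    fix e
    have "summable (\<lambda>n. norm (z ^ n *\<^sub>C a n))"
      using summ[of "cmod z"] z by (simp add: norm_scaleC norm_power mult.commute)
    then have "summable (\<lambda>n. z ^ n *\<^sub>C a n)" by (rule summable_norm_cancel)
    then have "(\<lambda>n. cinner (z ^ n *\<^sub>C a n) e) sums cinner (\<Sum>n. z ^ n *\<^sub>C a n) e"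
      by (intro bounded_linear.sums[OF bounded_linear_cinner_left] summable_sums)
    moreover have "(\<lambda>n. (deriv ^^ n) (\<lambda>z. cinner (f z) e) 0 / fact n * (z - 0) ^ n) sums cinner (f z) e"
      using z by (intro holomorphic_power_series[OF hol]) auto
    ultimately show "cinner (f z) e = cinner (\<Sum>n. z ^ n *\<^sub>C a n) e"
      by (simp add: cinner_scaleC_left a mult.commute sums_iff)
  qed
  then have "taylor_coeff f n = a n" by (intro taylor_coeff_powser[where r = "1/2"] summ) auto
  then show "cinner (taylor_coeff f n) e = (deriv ^^ n) (\<lambda>z. cinner (f z) e) 0 / fact n"
    by (simp add: a)
qed

section \<open>Area integrals over the disc\<close>

text \<open>Lebesgue measure is determined by its values on boxes. The preimage of a box is its
  image under the inverse map, which is again orthogonal and so preserves volume.\<close>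

lemma distr_lborel_orthogonal_transformation:
  fixes f :: "real ^ 'n::{finite,wellorder} \<Rightarrow> real ^ 'n::_"
  assumes f: "orthogonal_transformation f"
  shows "distr lborel borel f = lborel"
proof (rule lborel_eqI[symmetric])
  have lin: "linear f" using f by (rule orthogonal_transformation_linear)
  have cont: "continuous_on UNIV f"
    using lin linear_continuous_on linear_conv_bounded_linear by blast
  have meas[measurable]: "f \<in> borel_measurable borel"
    using cont by (rule borel_measurable_continuous_onI)
  fix l u :: "real ^ 'n::_"
  assume le: "\<And>b. b \<in> Basis \<Longrightarrow> l \<bullet> b \<le> u \<bullet> b"
  define g where "g = inv f"
  have g: "orthogonal_transformation g"
    unfolding g_def using f by (rule orthogonal_transformation_inv)
  have img: "f -` box l u = g ` box l u"
    unfolding g_def using bij_vimage_eq_inv_image[OF orthogonal_transformation_bij[OF f]] .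
  have fin: "emeasure lborel (f -` box l u) = ennreal (measure lebesgue (g ` box l u))"
  proof -
    have lm: "g ` box l u \<in> lmeasurable"
      using g by (rule measurable_orthogonal_image) simp
    have b: "f -` box l u \<in> sets borel"
      using measurable_sets[OF meas, of "box l u"] by simp
    have "emeasure lborel (f -` box l u) = emeasure lebesgue (g ` box l u)"
      using b by (simp add: img)
    also have "\<dots> = ennreal (measure lebesgue (g ` box l u))"
      using lm by (intro emeasure_eq_ennreal_measure) (auto simp: fmeasurable_def)
    finally show ?thesis .
  qed
  have "emeasure (distr lborel borel f) (box l u) = emeasure lborel (f -` box l u)"
    by (subst emeasure_distr) auto
  also have "\<dots> = ennreal (measure lebesgue (box l u))"
    unfolding fin using measure_orthogonal_image[OF g, of "box l u"] by simp
  also have "\<dots> = (\<Prod>b\<in>Basis. (u - l) \<bullet> b)"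
    using le by (simp add: measure_lborel_box_eq)
  finally show "emeasure (distr lborel borel f) (box l u) = (\<Prod>b\<in>Basis. (u - l) \<bullet> b)" .
qed simp

text \<open>Identifies the plane \<open>real ^ 2\<close> with the complex numbers as measure spaces:
  boxes correspond to boxes with the same side lengths.\<close>

lemma distr_lborel_Complex:
  "distr lborel borel (\<lambda>v :: real ^ 2. Complex (v $ 1) (v $ 2)) = lborel"
proof (rule lborel_eqI[symmetric])
  let ?T = "\<lambda>v :: real ^ 2. Complex (v $ 1) (v $ 2)"
  have [measurable]: "?T \<in> borel_measurable borel"
    by (intro borel_measurable_continuous_onI continuous_intros)
  fix l u :: complex
  assume le: "\<And>b. b \<in> Basis \<Longrightarrow> l \<bullet> b \<le> u \<bullet> b"
  let ?v = "\<lambda>z. \<chi> i :: 2. if i = 1 then Re z else Im z"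
  have box: "?T -` box l u = box (?v l) (?v u)"
    by (auto simp: mem_box_cart forall_2 in_box_complex_iff)
  have B: "Basis = (\<lambda>i::2. axis i (1::real)) ` {1, 2}"
    by (auto simp: Basis_vec_def UNIV_2)
  have "emeasure (distr lborel borel ?T) (box l u) = emeasure lborel (box (?v l) (?v u))"
    by (subst emeasure_distr) (auto simp: box)
  also have "\<dots> = ennreal (\<Prod>b\<in>Basis. (?v u - ?v l) \<bullet> b)"
    using le[of 1] le[of \<i>]
    by (subst emeasure_lborel_box_eq) (auto simp: B inner_axis Basis_complex_def)
  also have "(\<Prod>b\<in>Basis. (?v u - ?v l) \<bullet> b) = (\<Prod>b\<in>Basis. (u - l) \<bullet> b)"
    by (simp add: B inner_axis Basis_complex_def axis_eq_axis)
  finally show "emeasure (distr lborel borel ?T) (box l u) = (\<Prod>b\<in>Basis. (u - l) \<bullet> b)" .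
qed simp

text \<open>Under the identification with \<open>real ^ 2\<close>, multiplication by a unimodular
  number preserves the norm and is therefore an orthogonal map.\<close>

lemma distr_lborel_rotation:
  assumes w: "cmod w = 1"
  shows "distr lborel borel (\<lambda>z. w * z) = (lborel :: complex measure)"
proof -
  let ?T = "\<lambda>v :: real ^ 2. Complex (v $ 1) (v $ 2)"
  let ?R = "\<lambda>v :: real ^ 2. (\<chi> i. if i = 1 then Re (w * ?T v) else Im (w * ?T v)) :: real ^ 2"
  have [measurable]: "?T \<in> borel_measurable borel"
    by (intro borel_measurable_continuous_onI continuous_intros)
  have nT: "norm v = cmod (?T v)" for v :: "real ^ 2"
    by (simp add: norm_vec_def L2_set_def UNIV_2 cmod_def)
  have TR: "?T (?R v) = w * ?T v" for v
    by (simp add: complex_eq_iff)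
  have ot: "orthogonal_transformation ?R"
    unfolding orthogonal_transformation
  proof
    show "linear ?R"
      by (intro linearI) (auto simp: vec_eq_iff algebra_simps)
    show "\<forall>v. norm (?R v) = norm v"
      by (simp only: nT TR norm_mult w) simp
  qed
  have [measurable]: "?R \<in> borel_measurable borel"
    using ot linear_continuous_on linear_conv_bounded_linear orthogonal_transformation_linear
    by (intro borel_measurable_continuous_onI) blast
  have "distr lborel borel (\<lambda>z. w * z) = distr (distr lborel borel ?T) borel (\<lambda>z. w * z)"
    by (simp only: distr_lborel_Complex)
  also have "\<dots> = distr lborel borel ((\<lambda>z. w * z) \<circ> ?T)"
    by (subst distr_distr) auto
  also have "\<dots> = distr lborel borel (?T \<circ> ?R)"
    by (rule arg_cong[where f = "distr lborel borel"], intro ext) (simp only: comp_apply TR)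
  also have "\<dots> = distr (distr lborel borel ?R) borel ?T"
    by (subst distr_distr) auto
  also have "\<dots> = lborel"
    by (simp only: distr_lborel_orthogonal_transformation[OF ot] distr_lborel_Complex)
  finally show ?thesis .
qed

section \<open>Radial integrals over the disc\<close>

text \<open>Polar coordinates for radial functions. The two measures are compared on the rays
  \<open>{x<..}\<close>; with \<open>y\<close> the point \<open>x\<close> clamped to the unit
  interval, both give the area \<open>pi (1 - y^2)\<close> of an annulus.\<close>

lemma distr_disc_cmod:
  "distr (density lborel (indicator (ball 0 1))) borel cmod =
     density lborel (\<lambda>r. ennreal (2 * pi * r) * indicator {0..1} r)"
proof (rule measure_eqI_lessThan)
  fix x :: real
  have [measurable]: "ball (0::complex) 1 \<in> sets borel" by simp
  have [measurable]: "cmod -` {x<..} \<in> sets borel"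
    using measurable_sets[of cmod borel borel "{x<..}"] by simp
  let ?M = "distr (density lborel (indicator (ball (0::complex) 1))) borel cmod"
  let ?N = "density lborel (\<lambda>r. ennreal (2 * pi * r) * indicator {0..1} r)"
  define y where "y = min 1 (max 0 x)"
  have y: "0 \<le> y" "y \<le> 1" by (auto simp: y_def)
  have "emeasure ?M {x<..} = emeasure (density lborel (indicator (ball (0::complex) 1))) (cmod -` {x<..})"
    by (subst emeasure_distr) auto
  also have "\<dots> = emeasure lborel (ball 0 1 \<inter> cmod -` {x<..})"
    by (simp add: emeasure_density flip: indicator_inter_arith)
  \<comment> \<open>For negative \<open>x\<close> nothing is removed from the disc, whereas
    \<open>cball 0 0\<close> would remove the origin.\<close>
  also have "\<dots> = emeasure lborel (ball 0 1 - (if x < 0 then {} else cball (0::complex) y))"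
    by (rule arg_cong[where f = "emeasure lborel"])
      (auto simp: y_def intro: less_le_trans[OF _ norm_ge_zero])
  also have "\<dots> = ennreal (pi * (1 - y\<^sup>2))"
  proof (cases "x < 0")
    case True
    then show ?thesis
      by (simp add: emeasure_ball unit_ball_vol_2 y_def)
  next
    case False
    consider "y = 1" | "y < 1" using y by linarith
    then show ?thesis
    proof cases
      case 1
      then have "ball (0::complex) 1 - (if x < 0 then {} else cball (0::complex) y) = {}"
        using False by auto
      then show ?thesis using 1 by (simp only:) simp
    next
      case 2
      then have "cball (0::complex) y \<subseteq> ball 0 1" by auto
      then have "emeasure lborel (ball 0 1 - cball (0::complex) y)
          = emeasure lborel (ball (0::complex) 1) - emeasure lborel (cball (0::complex) y)"
        using y by (intro emeasure_Diff) (auto simp: emeasure_cball)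
      also have "\<dots> = ennreal (pi * (1 - y\<^sup>2))"
        using y by (simp add: emeasure_ball emeasure_cball unit_ball_vol_2 algebra_simps ennreal_minus
           power_le_one)
      finally show ?thesis using False by simp
    qed
  qed
  finally have M: "emeasure ?M {x<..} = ennreal (pi * (1 - y\<^sup>2))" .
  have "emeasure ?N {x<..} = (\<integral>\<^sup>+r. ennreal (2 * pi * r) * indicator {y..1} r \<partial>lborel)"
  proof -
    \<comment> \<open>The open ray and the closed interval from \<open>y\<close> to 1 differ at most
      in the point \<open>y\<close>, a null set.\<close>
    have "AE r in lborel. r \<noteq> y" by (rule AE_lborel_singleton)
    then show ?thesis
      by (subst emeasure_density) (auto intro!: nn_integral_cong_AE elim!: eventually_mono
        simp: indicator_def y_def split: if_splits)
  qed
  also have "\<dots> = ennreal (pi * 1\<^sup>2 - pi * y\<^sup>2)"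
    using y by (intro nn_integral_FTC_Icc[where F = "\<lambda>r. pi * r\<^sup>2"])
      (auto intro!: derivative_eq_intros)
  also have "\<dots> = ennreal (pi * (1 - y\<^sup>2))" by (simp add: algebra_simps)
  finally have N: "emeasure ?N {x<..} = ennreal (pi * (1 - y\<^sup>2))" .
  show "emeasure ?M {x<..} = emeasure ?N {x<..}" "emeasure ?M {x<..} < \<infinity>"
    by (simp_all only: M N) simp
qed auto

lemma nn_integral_disc_radial:
  assumes [measurable]: "h \<in> borel_measurable borel"
  shows "(\<integral>\<^sup>+ z \<in> ball (0::complex) 1. h (cmod z) \<partial>lborel) =
    (\<integral>\<^sup>+ r. ennreal (2 * pi * r) * h r * indicator {0..1} r \<partial>lborel)"
proof -
  have [measurable]: "ball (0::complex) 1 \<in> sets borel" by simp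
  have "(\<integral>\<^sup>+ z \<in> ball (0::complex) 1. h (cmod z) \<partial>lborel)
      = (\<integral>\<^sup>+ z. h (cmod z) \<partial>density lborel (indicator (ball (0::complex) 1)))"
    by (subst nn_integral_density) (auto simp: mult.commute)
  also have "\<dots> = (\<integral>\<^sup>+ r. h r \<partial>distr (density lborel (indicator (ball (0::complex) 1))) borel cmod)"
    by (subst nn_integral_distr) auto
  also have "\<dots> = (\<integral>\<^sup>+ r. ennreal (2 * pi * r) * indicator {0..1} r * h r \<partial>lborel)"
    unfolding distr_disc_cmod by (subst nn_integral_density) auto
  finally show ?thesis by (simp add: mult_ac)
qed

lemma DERIV_power_quotient:
  fixes r :: real
  assumes "0 < k"
  shows "((\<lambda>r. c / real k * r ^ k) has_real_derivative c * r ^ (k - 1)) (at r within S)"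
  using DERIV_cmult[OF DERIV_pow[of k r S], of "c / real k"] assms by simp

lemma nn_integral_disc_power:
  "(\<integral>\<^sup>+ z \<in> ball (0::complex) 1. ennreal (cmod z ^ n) \<partial>lborel) = ennreal (2 * pi / (n + 2))"
proof -
  have "(\<integral>\<^sup>+ z \<in> ball (0::complex) 1. ennreal (cmod z ^ n) \<partial>lborel)
      = (\<integral>\<^sup>+ r. ennreal (2 * pi * r) * ennreal (r ^ n) * indicator {0..1} r \<partial>lborel)"
    by (rule nn_integral_disc_radial[of "\<lambda>r. ennreal (r ^ n)"]) measurable
  also have "\<dots> = (\<integral>\<^sup>+ r. ennreal (2 * pi * r ^ (n + 1)) * indicator {0..1} r \<partial>lborel)"
    by (intro nn_integral_cong) (auto simp: indicator_def mult_ac simp flip: ennreal_mult)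
  also have "\<dots> = ennreal (2 * pi / real (n + 2) * 1 ^ (n + 2) - 2 * pi / real (n + 2) * 0 ^ (n + 2))"
  proof (intro nn_integral_FTC_Icc[where F = "\<lambda>r. 2 * pi / real (n + 2) * r ^ (n + 2)"])
    show "((\<lambda>r. 2 * pi / real (n + 2) * r ^ (n + 2)) has_real_derivative 2 * pi * r ^ (n + 1))
        (at r)" for r
      using DERIV_power_quotient[of "n + 2" "2 * pi" r UNIV] by (simp del: power_Suc)
  qed auto
  finally show ?thesis by simp
qed

text \<open>The radial integrand is \<open>2 pi (r^(2n+1) - r^(2n+3))\<close>, whose integral is
  \<open>pi / (n+1) - pi / (n+2)\<close>.\<close>

lemma nn_integral_disc_power_weighted:
  "(\<integral>\<^sup>+ z \<in> ball (0::complex) 1. ennreal (cmod z ^ (2 * n) * (1 - (cmod z)\<^sup>2)) \<partial>lborel)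
     = ennreal (pi / ((n + 1) * (n + 2)))"
proof -
  have "(\<integral>\<^sup>+ z \<in> ball (0::complex) 1. ennreal (cmod z ^ (2 * n) * (1 - (cmod z)\<^sup>2)) \<partial>lborel)
      = (\<integral>\<^sup>+ r. ennreal (2 * pi * r) * ennreal (r ^ (2 * n) * (1 - r\<^sup>2)) * indicator {0..1} r \<partial>lborel)"
    by (rule nn_integral_disc_radial[of "\<lambda>r. ennreal (r ^ (2 * n) * (1 - r\<^sup>2))"]) measurable
  also have "\<dots> = (\<integral>\<^sup>+ r. ennreal (2 * pi * (r ^ (2 * n + 1) - r ^ (2 * n + 3))) * indicator {0..1} r \<partial>lborel)"
    by (intro nn_integral_cong)
      (auto simp: indicator_def algebra_simps power_add power2_eq_square power3_eq_cube
        power_le_one mult_le_one simp flip: ennreal_mult')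
  also have "\<dots> = ennreal ((2 * pi / real (2 * n + 2) * 1 ^ (2 * n + 2) - 2 * pi / real (2 * n + 4) * 1 ^ (2 * n + 4))
      - (2 * pi / real (2 * n + 2) * 0 ^ (2 * n + 2) - 2 * pi / real (2 * n + 4) * 0 ^ (2 * n + 4)))"
  proof (intro nn_integral_FTC_Icc[where F = "\<lambda>r. 2 * pi / real (2 * n + 2) * r ^ (2 * n + 2) - 2 * pi / real (2 * n + 4) * r ^ (2 * n + 4)"])
    fix r :: real
    assume r: "r \<in> {0..1}"
    show "((\<lambda>r. 2 * pi / real (2 * n + 2) * r ^ (2 * n + 2) - 2 * pi / real (2 * n + 4) * r ^ (2 * n + 4)) has_real_derivative
        2 * pi * (r ^ (2 * n + 1) - r ^ (2 * n + 3))) (at r)"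
      using DERIV_diff[OF DERIV_power_quotient[of "2 * n + 2" "2 * pi" r UNIV]
          DERIV_power_quotient[of "2 * n + 4" "2 * pi" r UNIV]]
      by (simp add: right_diff_distrib eval_nat_numeral del: power_Suc)
    show "0 \<le> 2 * pi * (r ^ (2 * n + 1) - r ^ (2 * n + 3))"
      using r power_decreasing[of "2 * n + 1" "2 * n + 3" r] by (intro mult_nonneg_nonneg) auto
  qed auto
  also have "\<dots> = ennreal (pi / ((n + 1) * (n + 2)))"
  proof -
    have "2 * pi / real (2 * n + 2) = pi / (real n + 1)" "2 * pi / real (2 * n + 4) = pi / (real n + 2)"
      by (simp_all add: field_simps)
    moreover have "pi / (real n + 1) - pi / (real n + 2) = pi / ((real n + 1) * (real n + 2))"
      by (simp add: divide_simps) (simp add: algebra_simps)?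
    ultimately show ?thesis by (simp add: zero_power algebra_simps)
  qed
  finally show ?thesis .
qed

section \<open>Orthogonality of monomials\<close>

text \<open>A suitable rotation changes the sign of the integrand while preserving the measure, so
  the integral equals its own negative.\<close>

lemma disc_monomial_orthogonal:
  assumes "m \<noteq> l"
  shows "(LINT z|lborel. indicator (ball (0::complex) 1) z *\<^sub>R (of_real (cmod z ^ k) * (cnj z ^ m * z ^ l))) = 0"
    (is "?J = 0")
proof -
  \<comment> \<open>The angle solves \<open>(l - m) \<theta> = pi\<close>. The subtraction is real,
    so both orders of \<open>m\<close> and \<open>l\<close> are covered.\<close>
  define \<theta> where "\<theta> = pi / (real l - real m)"
  define w where "w = cis \<theta>"
  have "cmod w = 1" by (simp add: w_def)
  have "cnj w ^ m * w ^ l = cis (real l * \<theta> - real m * \<theta>)"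
    unfolding w_def cis_cnj Complex.DeMoivre cis_mult by (rule arg_cong[where f = cis]) simp
  also have "real l * \<theta> - real m * \<theta> = pi"
    using assms unfolding left_diff_distrib[symmetric] by (simp add: \<theta>_def)
  finally have w: "cnj w ^ m * w ^ l = -1" by simp
  let ?F = "\<lambda>z::complex. indicator (ball 0 1) z *\<^sub>R (of_real (cmod z ^ k) * (cnj z ^ m * z ^ l))"
  have [measurable]: "ball (0::complex) 1 \<in> sets borel" by simp
  have [measurable]: "cnj \<in> borel_measurable borel"
    by (intro borel_measurable_continuous_onI continuous_intros)
  have "?J = (LINT z|distr lborel borel (\<lambda>z. w * z). ?F z)"
    by (simp only: distr_lborel_rotation[OF \<open>cmod w = 1\<close>])
  also have "\<dots> = (LINT z|lborel. ?F (w * z))"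
    by (rule integral_distr) measurable
  also have "\<dots> = (LINT z|lborel. - ?F z)"
  proof (rule Bochner_Integration.integral_cong)
    fix z
    have "(cnj (w * z)) ^ m * (w * z) ^ l = (cnj w ^ m * w ^ l) * (cnj z ^ m * z ^ l)"
      by (simp add: power_mult_distrib mult_ac)
    then show "?F (w * z) = - ?F z"
      using \<open>cmod w = 1\<close> by (simp add: w norm_mult indicator_def)
  qed simp
  also have "\<dots> = - ?J" by simp
  finally show ?thesis by simp
qed

text \<open>Parseval's identity on the disc with a radial weight. The variable is
  \<open>cnj z\<close> because the test functions are evaluated there.\<close>

lemma nn_integral_disc_polynomial:
  fixes c :: "nat \<Rightarrow> complex"
  shows "(\<integral>\<^sup>+ z \<in> ball (0::complex) 1. ennreal (cmod z ^ k * (cmod (\<Sum>m<N. c m * cnj z ^ m))\<^sup>2) \<partial>lborel)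
    = (\<Sum>m<N. ennreal ((cmod (c m))\<^sup>2 * (2 * pi / (k + 2 * m + 2))))"
proof -
  let ?D = "ball (0::complex) 1"
  let ?P = "\<lambda>z. \<Sum>m<N. c m * cnj z ^ m"
  let ?F = "\<lambda>m l z. indicator ?D z *\<^sub>R (of_real (cmod z ^ k) * (cnj z ^ m * z ^ l))"
  let ?G = "\<lambda>z. indicator ?D z * (cmod z ^ k * (cmod (?P z))\<^sup>2)"
  have [measurable]: "?D \<in> sets borel" by simp
  have [measurable]: "cnj \<in> borel_measurable borel"
    by (intro borel_measurable_continuous_onI continuous_intros)
  have int: "integrable lborel (?F m l)" for m l
  proof (rule integrableI_bounded_set_indicator)
    show "AE z in lborel. z \<in> ?D \<longrightarrow> norm (of_real (cmod z ^ k) * (cnj z ^ m * z ^ l)) \<le> 1"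
      by (auto simp: norm_mult norm_power intro!: AE_I2 mult_le_one power_le_one)
    show "emeasure lborel ?D < \<infinity>" by (simp add: emeasure_ball)
  qed auto
  have diag: "(LINT z|lborel. ?F m m z) = of_real (2 * pi / (k + 2 * m + 2))" for m
  proof -
    have "?F m m z = of_real (indicator ?D z * cmod z ^ (k + 2 * m))" for z
    proof -
      have "cnj z ^ m * z ^ m = (complex_of_real ((cmod z)\<^sup>2)) ^ m"
        by (simp only: complex_norm_square power_mult_distrib mult.commute)
      also have "\<dots> = of_real (cmod z ^ (2 * m))"
        by (simp add: power_mult)
      finally show ?thesis by (simp add: scaleR_conv_of_real power_add)
    qed
    then have "(LINT z|lborel. ?F m m z) = of_real (LINT z|lborel. indicator ?D z * cmod z ^ (k + 2 * m))"
      by (simp only: integral_complex_of_real)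
    also have "(LINT z|lborel. indicator ?D z * cmod z ^ (k + 2 * m))
        = enn2real (\<integral>\<^sup>+ z \<in> ?D. ennreal (cmod z ^ (k + 2 * m)) \<partial>lborel)"
      by (subst integral_eq_nn_integral)
        (auto intro!: arg_cong[where f = enn2real] nn_integral_cong simp: indicator_def)
    finally show ?thesis by (simp add: nn_integral_disc_power)
  qed
  have G: "of_real (?G z) = (\<Sum>m<N. \<Sum>l<N. c m * cnj (c l) * ?F m l z)" for z
  proof -
    have "of_real ((cmod (?P z))\<^sup>2) = ?P z * cnj (?P z)" by (rule complex_norm_square)
    also have "\<dots> = (\<Sum>m<N. \<Sum>l<N. c m * cnj z ^ m * (cnj (c l) * z ^ l))"
      by (simp add: sum_product)
    finally show ?thesis
      by (simp add: scaleR_conv_of_real sum_distrib_left mult_ac del: of_real_power)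
  qed
  \<comment> \<open>The cross terms are complex, so the square is expanded under the Bochner
    integral. The return to the nonnegative integral comes once only diagonal terms are
    left.\<close>
  have "complex_of_real (LINT z|lborel. ?G z) = (LINT z|lborel. (\<Sum>m<N. \<Sum>l<N. c m * cnj (c l) * ?F m l z))"
    by (simp only: integral_complex_of_real[symmetric] G)
  also have "\<dots> = (\<Sum>m<N. \<Sum>l<N. c m * cnj (c l) * (LINT z|lborel. ?F m l z))"
  proof -
    have "(LINT z|lborel. (\<Sum>m<N. \<Sum>l<N. c m * cnj (c l) * ?F m l z))
        = (\<Sum>m<N. LINT z|lborel. (\<Sum>l<N. c m * cnj (c l) * ?F m l z))"
      by (intro Bochner_Integration.integral_sum Bochner_Integration.integrable_sum
          integrable_mult_right int)
    also have "\<dots> = (\<Sum>m<N. \<Sum>l<N. LINT z|lborel. c m * cnj (c l) * ?F m l z)"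
      by (intro sum.cong refl Bochner_Integration.integral_sum integrable_mult_right int)
    also have "\<dots> = (\<Sum>m<N. \<Sum>l<N. c m * cnj (c l) * (LINT z|lborel. ?F m l z))"
      by (simp only: integral_mult_right_zero)
    finally show ?thesis .
  qed
  also have "\<dots> = (\<Sum>m<N. \<Sum>l<N. if l = m then c m * cnj (c l) * of_real (2 * pi / (k + 2 * m + 2)) else 0)"
  proof (intro sum.cong refl)
    fix m l
    show "c m * cnj (c l) * (LINT z|lborel. ?F m l z)
        = (if l = m then c m * cnj (c l) * of_real (2 * pi / (k + 2 * m + 2)) else 0)"
    proof (cases "l = m")
      case True
      then show ?thesis by (simp only: diag simp_thms if_True)
    next
      case False
      then show ?thesis by (simp only: disc_monomial_orthogonal[OF not_sym[OF False]] if_False mult_zero_right)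
    qed
  qed
  also have "\<dots> = (\<Sum>m<N. of_real ((cmod (c m))\<^sup>2 * (2 * pi / (k + 2 * m + 2))))"
    by (intro sum.cong) (simp_all add: complex_norm_square del: of_real_power)
  finally have *: "(LINT z|lborel. ?G z) = (\<Sum>m<N. (cmod (c m))\<^sup>2 * (2 * pi / (k + 2 * m + 2)))"
    by (simp only: of_real_sum[symmetric] of_real_eq_iff)
  have "integrable lborel (\<lambda>z. complex_of_real (?G z))"
    unfolding G using int by (intro Bochner_Integration.integrable_sum integrable_mult_right)
  from integrable_Re[OF this] have "integrable lborel ?G" by (simp only: Re_complex_of_real)
  then have "(\<integral>\<^sup>+ z. ennreal (?G z) \<partial>lborel) = ennreal (LINT z|lborel. ?G z)"
    by (rule nn_integral_eq_integral) (auto intro!: AE_I2 simp: indicator_def)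
  also have "\<dots> = (\<Sum>m<N. ennreal ((cmod (c m))\<^sup>2 * (2 * pi / (k + 2 * m + 2))))"
    unfolding * by (rule sum_ennreal[symmetric]) simp
  finally show ?thesis
    by (subst (asm) nn_integral_cong[where v = "\<lambda>z. ennreal (cmod z ^ k * (cmod (?P z))\<^sup>2) * indicator ?D z"])
      (auto simp: indicator_def)
qed

text \<open>Fatou's lemma carries the orthogonality of monomials over from polynomials.\<close>

lemma nn_integral_disc_powser_le:
  fixes g :: "complex \<Rightarrow> complex"
  assumes g: "\<And>w. w \<in> ball 0 1 \<Longrightarrow> (\<lambda>m. c m * w ^ m) sums g w"
  shows "(\<integral>\<^sup>+ z \<in> ball 0 1. ennreal (cmod z ^ k * (cmod (g (cnj z)))\<^sup>2) \<partial>lborel)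
    \<le> ennreal (2 * pi / (k + 2)) * (\<Sum>m. ennreal ((cmod (c m))\<^sup>2))"
proof -
  let ?D = "ball (0::complex) 1"
  define u where "u N z = ennreal (cmod z ^ k * (cmod (\<Sum>m<N. c m * cnj z ^ m))\<^sup>2) * indicator ?D z" for N z
  have [measurable]: "?D \<in> sets borel" by simp
  have [measurable]: "cnj \<in> borel_measurable borel"
    by (intro borel_measurable_continuous_onI continuous_intros)
  have [measurable]: "u N \<in> borel_measurable lborel" for N
    unfolding u_def by measurable
  have lim: "liminf (\<lambda>N. u N z) = ennreal (cmod z ^ k * (cmod (g (cnj z)))\<^sup>2) * indicator ?D z" for z
  proof (cases "z \<in> ?D")
    case True
    then have "(\<lambda>N. \<Sum>m<N. c m * cnj z ^ m) \<longlonglongrightarrow> g (cnj z)"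
      using g[of "cnj z"] by (simp add: sums_def)
    then have "(\<lambda>N. u N z) \<longlonglongrightarrow> ennreal (cmod z ^ k * (cmod (g (cnj z)))\<^sup>2)"
      unfolding u_def using True by (simp, intro tendsto_intros)
    then show ?thesis using True by (simp add: lim_imp_Liminf)
  next
    case False
    then show ?thesis by (simp add: u_def Liminf_const)
  qed
  have "(\<integral>\<^sup>+ z \<in> ball 0 1. ennreal (cmod z ^ k * (cmod (g (cnj z)))\<^sup>2) \<partial>lborel)
      = (\<integral>\<^sup>+ z. liminf (\<lambda>N. u N z) \<partial>lborel)"
    by (simp only: lim)
  also have "\<dots> \<le> liminf (\<lambda>N. \<integral>\<^sup>+ z. u N z \<partial>lborel)"
    by (rule nn_integral_liminf) measurable
  also have "\<dots> \<le> ennreal (2 * pi / (k + 2)) * (\<Sum>m. ennreal ((cmod (c m))\<^sup>2))"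
  proof (rule Liminf_le)
    have "(\<integral>\<^sup>+ z. u N z \<partial>lborel) \<le> ennreal (2 * pi / (k + 2)) * (\<Sum>m. ennreal ((cmod (c m))\<^sup>2))" for N
    proof -
      have "(\<integral>\<^sup>+ z. u N z \<partial>lborel) = (\<Sum>m<N. ennreal ((cmod (c m))\<^sup>2 * (2 * pi / (k + 2 * m + 2))))"
        unfolding u_def by (rule nn_integral_disc_polynomial)
      \<comment> \<open>Each weight is replaced by its value at \<open>m = 0\<close>, the largest
        one, to get a factor independent of \<open>m\<close>.\<close>
      also have "\<dots> \<le> (\<Sum>m<N. ennreal (2 * pi / (k + 2)) * ennreal ((cmod (c m))\<^sup>2))"
      proof (intro sum_mono)
        fix m
        have "(cmod (c m))\<^sup>2 * (2 * pi / (k + 2 * m + 2)) \<le> (cmod (c m))\<^sup>2 * (2 * pi / (k + 2))"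
          by (intro mult_left_mono divide_left_mono) auto
        then show "ennreal ((cmod (c m))\<^sup>2 * (2 * pi / (k + 2 * m + 2)))
            \<le> ennreal (2 * pi / (k + 2)) * ennreal ((cmod (c m))\<^sup>2)"
          by (subst ennreal_mult[symmetric]) (auto intro!: ennreal_leI simp: mult.commute)
      qed
      also have "\<dots> = ennreal (2 * pi / (k + 2)) * (\<Sum>m<N. ennreal ((cmod (c m))\<^sup>2))"
        by (rule sum_distrib_left[symmetric])
      also have "\<dots> \<le> ennreal (2 * pi / (k + 2)) * (\<Sum>m. ennreal ((cmod (c m))\<^sup>2))"
        by (intro mult_left_mono sum_le_suminf) auto
      finally show ?thesis .
    qed
    then show "\<forall>\<^sub>F N in sequentially. (\<integral>\<^sup>+ z. u N z \<partial>lborel)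
        \<le> ennreal (2 * pi / (k + 2)) * (\<Sum>m. ennreal ((cmod (c m))\<^sup>2))"
      by (intro always_eventually allI)
  qed simp
  finally show ?thesis .
qed

section \<open>The counterexample\<close>

lemma esqrt_less_top_iff: "esqrt x < \<infinity> \<longleftrightarrow> x < \<infinity>"
  by (cases "x = \<infinity>") (simp_all add: esqrt_def flip: less_top)

lemma esqrt_eq_1_iff: "esqrt x = 1 \<longleftrightarrow> x = 1"
  by (cases x rule: ennreal_cases) (auto simp: esqrt_def)

lemma ennreal_less_topE:
  assumes "x < \<infinity>"
  obtains r where "x = ennreal r" "0 \<le> r"
  using assms by (cases x rule: ennreal_cases) auto

lemma le_suminf_ennreal: "f n \<le> (\<Sum>n. f n :: ennreal)"
  using sum_le_suminf[of f "{n}"] by simp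

text \<open>A single term is at most the whole series. With the constant coefficient this bounds the
  norm of a Hankel image from below.\<close>

lemma norm_le_H2_norm: "ennreal (norm (taylor_coeff f n)) \<le> H2_norm f"
proof -
  let ?S = "\<Sum>n. ennreal ((norm (taylor_coeff f n))\<^sup>2)"
  have "ennreal ((norm (taylor_coeff f n))\<^sup>2) \<le> ?S"
    by (rule le_suminf_ennreal)
  show ?thesis
  proof (cases ?S rule: ennreal_cases)
    case (real r)
    then have "(norm (taylor_coeff f n))\<^sup>2 \<le> r"
      using \<open>_ \<le> ?S\<close> by (simp add: ennreal_le_iff)
    then show ?thesis
      unfolding H2_norm_def esqrt_def using real by (simp add: ennreal_leI real_le_rsqrt)
  next
    case top
    then show ?thesis unfolding H2_norm_def esqrt_def by simp
  qed
qed

text \<open>Finite sums over \<open>n\<close> commute with the series in \<open>m\<close>. The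
  hypothesis is supplied by Bessel's inequality, applied to each Taylor coefficient.\<close>

lemma ennreal_suminf_suminf_le:
  fixes f :: "nat \<Rightarrow> nat \<Rightarrow> ennreal"
  assumes "\<And>N m. (\<Sum>n<N. f n m) \<le> g m"
  shows "(\<Sum>n m. f n m) \<le> (\<Sum>m. g m)"
proof (rule suminf_le_const)
  fix N
  have "(\<Sum>n<N. \<Sum>m. f n m) = (\<Sum>m. \<Sum>n<N. f n m)"
    by (rule suminf_sum[symmetric]) simp
  also have "\<dots> \<le> (\<Sum>m. g m)"
    using assms by (intro suminf_le) auto
  finally show "(\<Sum>n<N. \<Sum>m. f n m) \<le> (\<Sum>m. g m)" .
qed simp

text \<open>The shift \<open>j\<close> serves both denominators that occur: \<open>n + 2\<close>
  from the area integrals and \<open>n + 1\<close> from the Hankel operator.\<close>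

lemma harmonic_sum_unbounded: "\<exists>N. C < (\<Sum>n<N. 1 / real (n + j))"
proof (rule ccontr)
  assume "\<not> ?thesis"
  then have "summable (\<lambda>n. inverse (real (n + j)))"
    by (intro summableI_nonneg_bounded[of _ C]) (simp_all add: not_less inverse_eq_divide)
  then show False
    using not_summable_harmonic[where ?'a = real] summable_iff_shift[of "\<lambda>n. inverse (real n)" j] by simp
qed

section \<open>The symbol and its adjoint\<close>

text \<open>With respect to \<open>e\<close>, the operators have entries in the first row only. The
  weight is chosen so that \<open>Dop\<close> turns it into \<open>sqrt (n + 1)\<close>.\<close>

definition row_symbol :: "(nat \<Rightarrow> 'a::chilbert_space) \<Rightarrow> complex \<Rightarrow> ('a, 'a) cblinfun" where
  "row_symbol e z = (\<Sum>n. z ^ n *\<^sub>C ((1 / sqrt (n + 1)) *\<^sub>R rank_one (e 0) (e n)))"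

definition column_symbol :: "(nat \<Rightarrow> 'a::chilbert_space) \<Rightarrow> complex \<Rightarrow> ('a, 'a) cblinfun" where
  "column_symbol e z = (\<Sum>n. z ^ n *\<^sub>C ((1 / sqrt (n + 1)) *\<^sub>R rank_one (e n) (e 0)))"

lemma summable_powser_bounded:
  fixes a :: "nat \<Rightarrow> 'a::real_normed_vector"
  assumes "\<And>n. norm (a n) \<le> 1" "0 \<le> s" "s < 1"
  shows "summable (\<lambda>n. norm (a n) * s ^ n)"
proof (rule summable_comparison_test')
  show "summable (\<lambda>n. s ^ n)" using assms by simp
  show "norm (norm (a n) * s ^ n) \<le> s ^ n" if "n \<ge> 0" for n
    using mult_right_mono[OF assms(1)[of n], of "s ^ n"] assms(2) by simp
qed

lemma norm_weighted_rank_one_le: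
  assumes "norm v = 1" "norm w = 1"
  shows "norm ((1 / sqrt (real (n + 1))) *\<^sub>R rank_one v w) \<le> 1"
proof -
  have "norm ((1 / sqrt (real (n + 1))) *\<^sub>R rank_one v w) \<le> 1 / sqrt (real (n + 1)) * 1"
    using norm_rank_one_le[of v w] assms by (simp add: divide_right_mono)
  also have "\<dots> \<le> 1" by (simp add: divide_le_eq_1)
  finally show ?thesis .
qed

lemma powser_sums:
  fixes a :: "nat \<Rightarrow> 'a::cbanach"
  assumes "\<And>n. norm (a n) \<le> 1" "cmod z < 1"
  shows "(\<lambda>n. z ^ n *\<^sub>C a n) sums (\<Sum>n. z ^ n *\<^sub>C a n)"
proof (rule summable_sums, rule summable_norm_cancel)
  show "summable (\<lambda>n. norm (z ^ n *\<^sub>C a n))"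
    using summable_powser_bounded[of a "cmod z"] assms
    by (simp add: norm_scaleC norm_power mult.commute)
qed

text \<open>Bounded coefficients allow comparison with the differentiated geometric series.\<close>

lemma Dop_powser_sums:
  fixes a :: "nat \<Rightarrow> 'a::cbanach"
  assumes "\<And>n. norm (a n) \<le> 1" "\<And>n. taylor_coeff f n = a n" "cmod z < 1"
  shows "(\<lambda>n. z ^ n *\<^sub>C (of_nat (1 + n) *\<^sub>C a n)) sums Dop f z"
  unfolding Dop_def assms(2)
proof (rule summable_sums, rule summable_norm_cancel, rule summable_comparison_test')
  show "summable (\<lambda>n. real (Suc n) * cmod z ^ n)"
    using geometric_deriv_sums[of "cmod z"] assms(3) by (simp add: sums_iff del: of_nat_Suc)
  show "norm (norm (z ^ n *\<^sub>C (of_nat (1 + n) *\<^sub>C a n))) \<le> real (Suc n) * cmod z ^ n" if "n \<ge> 0" for n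
  proof -
    have "cmod z ^ n * (real (Suc n) * norm (a n)) \<le> cmod z ^ n * (real (Suc n) * 1)"
      by (intro mult_left_mono assms(1)) auto
    moreover have "norm (norm (z ^ n *\<^sub>C (of_nat (1 + n) *\<^sub>C a n)))
        = cmod z ^ n * (real (1 + n) * norm (a n))"
      by (simp only: norm_scaleC norm_power norm_of_nat real_norm_def abs_mult abs_norm_cancel abs_of_nat power_abs)
    ultimately show ?thesis by (simp add: mult.commute)
  qed
qed

lemma of_nat_mult_inverse_sqrt:
  "of_nat (1 + n) * complex_of_real (1 / sqrt (real (n + 1))) = of_real (sqrt (real (n + 1)))"
proof -
  have "real (1 + n) * (1 / sqrt (real (n + 1))) = sqrt (real (n + 1))"
    using real_div_sqrt[of "real (n + 1)"] by (simp add: add.commute)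
  then have "complex_of_real (real (1 + n) * (1 / sqrt (real (n + 1)))) = of_real (sqrt (real (n + 1)))"
    by (simp only:)
  then show ?thesis by (simp only: of_real_mult of_real_of_nat_eq)
qed

locale hilbert_orthonormal_seq =
  fixes e :: "nat \<Rightarrow> 'a::chilbert_space"
  assumes e: "orthonormal_seq e"
begin

lemmas norm_e = norm_orthonormal_seq[OF e]

text \<open>Both sides of the adjoint identity expand into the same series: the conjugate in
  \<open>cnj z\<close> cancels against conjugate linearity in the second slot, and the weights are
  real. The series are known to converge on the disc.\<close>

lemma sharp_row_symbol:
  assumes "z \<in> ball 0 1"
  shows "sharp (row_symbol e) z = column_symbol e z"
  unfolding sharp_def
proof (rule cadjoint_eqI)
  fix x y
  have "(\<lambda>n. cblinfun_apply (cnj z ^ n *\<^sub>C ((1 / sqrt (n + 1)) *\<^sub>R rank_one (e 0) (e n))) y)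
      sums cblinfun_apply (row_symbol e (cnj z)) y"
    unfolding row_symbol_def
    by (intro bounded_linear.sums[OF bounded_linear_cblinfun_apply_left] powser_sums
        norm_weighted_rank_one_le norm_e) (use assms in auto)
  from bounded_linear.sums[OF bounded_linear_cinner_right this, of x]
  have 1: "(\<lambda>n. (z ^ n / sqrt (n + 1)) * cnj (cinner y (e n)) * cinner x (e 0))
      sums cinner x (cblinfun_apply (row_symbol e (cnj z)) y)"
    by (simp add: cblinfun_apply_scaleC cblinfun_apply_scaleR cinner_scaleC_right
        cinner_scaleR_right scaleR_conv_of_real mult_ac)
  have "(\<lambda>n. cblinfun_apply (z ^ n *\<^sub>C ((1 / sqrt (n + 1)) *\<^sub>R rank_one (e n) (e 0))) x)
      sums cblinfun_apply (column_symbol e z) x"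
    unfolding column_symbol_def
    by (intro bounded_linear.sums[OF bounded_linear_cblinfun_apply_left] powser_sums
        norm_weighted_rank_one_le norm_e) (use assms in auto)
  from bounded_linear.sums[OF bounded_linear_cinner_left this, of y]
  have 2: "(\<lambda>n. (z ^ n / sqrt (n + 1)) * cinner (e n) y * cinner x (e 0))
      sums cinner (cblinfun_apply (column_symbol e z) x) y"
    by (simp add: cblinfun_apply_scaleC cblinfun_apply_scaleR cinner_scaleC_left
        cinner_scaleR_left scaleR_conv_of_real mult_ac)
  have "cnj (cinner y (e n)) = cinner (e n) y" for n
    by (rule cinner_commute[symmetric])
  with 1 2 show "cinner (cblinfun_apply (column_symbol e z) x) y
      = cinner x (cblinfun_apply (row_symbol e (cnj z)) y)"
    by (simp add: sums_iff)
qed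

lemma row_symbol_Hol: "row_symbol e \<in> Hol"
  unfolding Hol_def mem_Collect_eq
  by (rule analytic_in_powser[OF summable_powser_bounded[OF norm_weighted_rank_one_le[OF norm_e norm_e]]])
    (simp_all only: row_symbol_def)

lemma taylor_coeff_row_symbol:
  "taylor_coeff (row_symbol e) n = (1 / sqrt (n + 1)) *\<^sub>R rank_one (e 0) (e n)"
  by (rule taylor_coeff_powser[where r = 1,
        OF summable_powser_bounded[OF norm_weighted_rank_one_le[OF norm_e norm_e]]])
    (simp_all only: row_symbol_def zero_less_one)

lemma taylor_coeff_sharp_row_symbol:
  "taylor_coeff (sharp (row_symbol e)) n = (1 / sqrt (n + 1)) *\<^sub>R rank_one (e n) (e 0)"
  by (rule taylor_coeff_powser[where r = 1,
        OF summable_powser_bounded[OF norm_weighted_rank_one_le[OF norm_e norm_e]]])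
    (simp_all only: sharp_row_symbol column_symbol_def zero_less_one)

lemma Dop_row_symbol_sums:
  assumes "cmod z < 1"
  shows "(\<lambda>n. (z ^ n * of_real (sqrt (n + 1)) * cinner x (e n)) *\<^sub>C e 0)
    sums cblinfun_apply (Dop (row_symbol e) z) x"
proof -
  have "(\<lambda>n. cblinfun_apply (z ^ n *\<^sub>C (of_nat (1 + n) *\<^sub>C
      ((1 / sqrt (n + 1)) *\<^sub>R rank_one (e 0) (e n)))) x) sums cblinfun_apply (Dop (row_symbol e) z) x"
    using norm_weighted_rank_one_le[OF norm_e norm_e] assms
    by (intro bounded_linear.sums[OF bounded_linear_cblinfun_apply_left] Dop_powser_sums
        taylor_coeff_row_symbol) auto
  moreover note of_nat_mult_inverse_sqrt
  ultimately show ?thesis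
    by (simp only: cblinfun_apply_scaleC rank_one_apply scaleC_scaleC scaleC_of_real[symmetric]
        mult.assoc[symmetric])
qed

text \<open>At \<open>e 0\<close> every rank-one term contributes its own \<open>e n\<close>. The
  terms are mutually orthogonal, in contrast to the row symbol, where all of them are multiples of
  \<open>e 0\<close>.\<close>

lemma Dop_sharp_row_symbol_sums:
  assumes "cmod z < 1"
  shows "(\<lambda>n. (z ^ n * of_real (sqrt (n + 1))) *\<^sub>C e n)
    sums cblinfun_apply (Dop (sharp (row_symbol e)) z) (e 0)"
proof -
  have "(\<lambda>n. cblinfun_apply (z ^ n *\<^sub>C (of_nat (1 + n) *\<^sub>C
      ((1 / sqrt (n + 1)) *\<^sub>R rank_one (e n) (e 0)))) (e 0))
      sums cblinfun_apply (Dop (sharp (row_symbol e)) z) (e 0)"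
    using norm_weighted_rank_one_le[OF norm_e norm_e] assms
    by (intro bounded_linear.sums[OF bounded_linear_cblinfun_apply_left] Dop_powser_sums
        taylor_coeff_sharp_row_symbol) auto
  moreover note of_nat_mult_inverse_sqrt
  moreover have "cinner (e 0) (e 0) = 1" by (simp add: orthonormal_seqD[OF e])
  ultimately show ?thesis
    by (simp only: cblinfun_apply_scaleC rank_one_apply scaleC_scaleC scaleC_of_real[symmetric]
        mult.assoc[symmetric] scaleC_1)
qed

section \<open>The area condition for the row symbol\<close>

text \<open>
  Cauchy--Schwarz with the weights \<open>r\<^sup>n\<close>, whose sum \<open>1 / (1 - r)\<close> is
  absorbed by the weight of the area integral.
\<close>

lemma norm_Dop_row_symbol_le:
  assumes z: "cmod z < 1"
  shows "ennreal ((norm (cblinfun_apply (Dop (row_symbol e) z) x))\<^sup>2 * (1 - (cmod z)\<^sup>2))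
    \<le> (\<Sum>n. ennreal (2 * real (n + 1)) * ennreal (cmod z ^ n * (cmod (cinner x (e n)))\<^sup>2))"
proof (rule LIMSEQ_le_const2)
  define r where "r = cmod z"
  have r: "0 \<le> r" "r < 1" using z by (auto simp: r_def)
  define t where "t n = z ^ n * of_real (sqrt (n + 1)) * cinner x (e n)" for n
  have "(\<lambda>N. \<Sum>n<N. t n *\<^sub>C e 0) \<longlonglongrightarrow> cblinfun_apply (Dop (row_symbol e) z) x"
    using Dop_row_symbol_sums[OF z] unfolding t_def sums_def .
  then show "(\<lambda>N. ennreal ((norm (\<Sum>n<N. t n *\<^sub>C e 0))\<^sup>2 * (1 - (cmod z)\<^sup>2)))
      \<longlonglongrightarrow> ennreal ((norm (cblinfun_apply (Dop (row_symbol e) z) x))\<^sup>2 * (1 - (cmod z)\<^sup>2))"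
    by (intro tendsto_intros)
  \<comment> \<open>The estimate is proved for partial sums against the full series on the right, so
    it survives the limit.\<close>
  have "ennreal ((norm (\<Sum>n<N. t n *\<^sub>C e 0))\<^sup>2 * (1 - (cmod z)\<^sup>2))
      \<le> (\<Sum>n. ennreal (2 * real (n + 1)) * ennreal (cmod z ^ n * (cmod (cinner x (e n)))\<^sup>2))" for N
  proof -
    define y where "y n = real (n + 1) * (r ^ n * (cmod (cinner x (e n)))\<^sup>2)" for n
    have y0: "0 \<le> y n" for n using r by (simp add: y_def)
    have nt: "cmod (t n) = sqrt (r ^ n) * sqrt (y n)" for n
      using r by (simp add: t_def y_def norm_mult norm_power r_def[symmetric]
          real_sqrt_mult real_sqrt_power[symmetric] mult_ac flip: power2_eq_square)
    have "norm (\<Sum>n<N. t n *\<^sub>C e 0) \<le> (\<Sum>n<N. cmod (t n))"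
      by (rule order_trans[OF norm_sum]) (simp add: norm_scaleC norm_e)
    then have "(norm (\<Sum>n<N. t n *\<^sub>C e 0))\<^sup>2 \<le> (\<Sum>n<N. sqrt (r ^ n) * sqrt (y n))\<^sup>2"
      unfolding nt by (rule power_mono) simp
    also have "\<dots> \<le> (\<Sum>n<N. (sqrt (r ^ n))\<^sup>2) * (\<Sum>n<N. (sqrt (y n))\<^sup>2)"
      by (rule Cauchy_Schwarz_ineq_sum)
    also have "\<dots> = (\<Sum>n<N. r ^ n) * (\<Sum>n<N. y n)"
      using r y0 by simp
    finally have "(norm (\<Sum>n<N. t n *\<^sub>C e 0))\<^sup>2 * (1 - r\<^sup>2)
        \<le> (\<Sum>n<N. r ^ n) * (\<Sum>n<N. y n) * (1 - r\<^sup>2)"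
      using r by (intro mult_right_mono) (auto simp: power_le_one)
    \<comment> \<open>Splitting \<open>1 - r^2\<close> into \<open>(1 + r) (1 - r)\<close> lets the
      second factor collapse the geometric sum to \<open>1 - r ^ N\<close>. What remains is at most
      2.\<close>
    also have "\<dots> = ((1 + r) * ((1 - r) * (\<Sum>n<N. r ^ n))) * (\<Sum>n<N. y n)"
      by (simp add: power2_eq_square algebra_simps)
    also have "(1 - r) * (\<Sum>n<N. r ^ n) = 1 - r ^ N"
      by (rule one_diff_power_eq[symmetric])
    also have "(1 + r) * (1 - r ^ N) * (\<Sum>n<N. y n) \<le> 2 * (\<Sum>n<N. y n)"
    proof (rule mult_right_mono)
      have "(1 + r) * (1 - r ^ N) \<le> 2 * 1" using r by (intro mult_mono) (auto simp: power_le_one)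
      then show "(1 + r) * (1 - r ^ N) \<le> 2" by simp
    qed (simp add: sum_nonneg y0)
    finally have "ennreal ((norm (\<Sum>n<N. t n *\<^sub>C e 0))\<^sup>2 * (1 - r\<^sup>2)) \<le> ennreal (\<Sum>n<N. 2 * y n)"
      by (intro ennreal_leI) (simp add: sum_distrib_left)
    also have "\<dots> = (\<Sum>n<N. ennreal (2 * y n))" using y0 by (intro sum_ennreal[symmetric]) simp
    also have "\<dots> \<le> (\<Sum>n. ennreal (2 * y n))" by (rule sum_le_suminf) auto
    also have "(\<lambda>n. ennreal (2 * y n)) = (\<lambda>n. ennreal (2 * real (n + 1)) *
        ennreal (r ^ n * (cmod (cinner x (e n)))\<^sup>2))"
      using r by (intro ext, subst ennreal_mult[symmetric]) (auto simp: y_def mult_ac)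
    finally show ?thesis by (simp only: r_def)
  qed
  then show "\<exists>M. \<forall>N\<ge>M. ennreal ((norm (\<Sum>n<N. t n *\<^sub>C e 0))\<^sup>2 * (1 - (cmod z)\<^sup>2))
      \<le> (\<Sum>n. ennreal (2 * real (n + 1)) * ennreal (cmod z ^ n * (cmod (cinner x (e n)))\<^sup>2))"
    by blast
qed

text \<open>The factor \<open>2 (n + 1)\<close> of the pointwise bound meets
  \<open>2 pi / (n + 2)\<close> from the area integral, and their product stays below
  \<open>4 pi\<close> for all \<open>n\<close>. Bessel's inequality then bounds the remaining double
  sum by the squared norm of \<open>f\<close>, which is 1.\<close>

lemma row_symbol_integral_le:
  assumes f: "f \<in> Hol_ext1"
  shows "(\<integral>\<^sup>+ z\<in>unit_disc. ennreal ((norm (cblinfun_apply (Dop (row_symbol e) z) (f (cnj z))))\<^sup>2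
    * (1 - (cmod z)\<^sup>2)) \<partial>lborel) \<le> ennreal (4 * pi)"
proof -
  have fH: "f \<in> Hol" and "H2_norm f = 1" using f by (auto simp: Hol_ext1_def Hol_ext_def)
  then have H2: "(\<Sum>m. ennreal ((norm (taylor_coeff f m))\<^sup>2)) = 1"
    by (simp add: H2_norm_def esqrt_eq_1_iff)
  define h where "h n z = ennreal (cmod z ^ n * (cmod (cinner (f (cnj z)) (e n)))\<^sup>2) * indicator unit_disc z"
    for n and z :: complex
  \<comment> \<open>Nothing is known about \<open>f\<close> outside the disc, so measurability comes
    from continuity on the disc together with the indicator.\<close>
  have meas[measurable]: "h n \<in> borel_measurable lborel" for n
  proof -
    have "continuous_on unit_disc (\<lambda>z. cinner (f (cnj z)) (e n))"
      by (rule continuous_on_compose2[OF holomorphic_on_imp_continuous_on[OF holomorphic_cinner[OF fH]]])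
        (auto intro!: continuous_intros)
    then have "(\<lambda>z. indicator unit_disc z *\<^sub>R (cmod z ^ n * (cmod (cinner (f (cnj z)) (e n)))\<^sup>2))
        \<in> borel_measurable borel"
      by (intro borel_measurable_continuous_on_indicator continuous_intros) auto
    then have "(\<lambda>z. ennreal (indicator unit_disc z *\<^sub>R (cmod z ^ n * (cmod (cinner (f (cnj z)) (e n)))\<^sup>2)))
        \<in> borel_measurable borel"
      by measurable
    moreover have "h n = (\<lambda>z. ennreal (indicator unit_disc z *\<^sub>R (cmod z ^ n * (cmod (cinner (f (cnj z)) (e n)))\<^sup>2)))"
      by (auto simp: h_def fun_eq_iff indicator_def)
    ultimately show ?thesis by simp
  qed
  have "(\<integral>\<^sup>+ z\<in>unit_disc. ennreal ((norm (cblinfun_apply (Dop (row_symbol e) z) (f (cnj z))))\<^sup>2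
      * (1 - (cmod z)\<^sup>2)) \<partial>lborel) \<le> (\<integral>\<^sup>+ z. (\<Sum>n. ennreal (2 * real (n + 1)) * h n z) \<partial>lborel)"
  proof (rule nn_integral_mono)
    fix z :: complex
    show "ennreal ((norm (cblinfun_apply (Dop (row_symbol e) z) (f (cnj z))))\<^sup>2 * (1 - (cmod z)\<^sup>2))
        * indicator unit_disc z \<le> (\<Sum>n. ennreal (2 * real (n + 1)) * h n z)"
      using norm_Dop_row_symbol_le[of z "f (cnj z)"] by (simp add: h_def indicator_def)
  qed
  also have "\<dots> = (\<Sum>n. ennreal (2 * real (n + 1)) * (\<integral>\<^sup>+ z. h n z \<partial>lborel))"
    by (subst nn_integral_suminf) (auto simp: nn_integral_cmult)
  also have "\<dots> \<le> (\<Sum>n. ennreal (4 * pi) * (\<Sum>m. ennreal ((cmod (cinner (taylor_coeff f m) (e n)))\<^sup>2)))"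
  proof (intro suminf_le)
    fix n
    have "(\<lambda>m. cinner (taylor_coeff f m) (e n) * w ^ m) sums cinner (f w) (e n)" if "w \<in> ball 0 1" for w
      using holomorphic_power_series[OF holomorphic_cinner[OF fH] that]
      by (simp add: cinner_taylor_coeff[OF fH])
    then have "(\<integral>\<^sup>+ z. h n z \<partial>lborel)
        \<le> ennreal (2 * pi / (n + 2)) * (\<Sum>m. ennreal ((cmod (cinner (taylor_coeff f m) (e n)))\<^sup>2))"
      unfolding h_def by (rule nn_integral_disc_powser_le)
    then have "ennreal (2 * real (n + 1)) * (\<integral>\<^sup>+ z. h n z \<partial>lborel)
        \<le> ennreal (2 * real (n + 1)) * (ennreal (2 * pi / (n + 2)) *
            (\<Sum>m. ennreal ((cmod (cinner (taylor_coeff f m) (e n)))\<^sup>2)))"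
      by (rule mult_left_mono) simp
    also have "\<dots> = ennreal (2 * real (n + 1) * (2 * pi / (n + 2))) *
            (\<Sum>m. ennreal ((cmod (cinner (taylor_coeff f m) (e n)))\<^sup>2))"
      by (subst ennreal_mult) (auto simp: mult.assoc)
    also have "\<dots> \<le> ennreal (4 * pi) * (\<Sum>m. ennreal ((cmod (cinner (taylor_coeff f m) (e n)))\<^sup>2))"
      by (intro mult_right_mono ennreal_leI) (auto simp: divide_simps algebra_simps)
    finally show "ennreal (2 * real (n + 1)) * (\<integral>\<^sup>+ z. h n z \<partial>lborel)
        \<le> ennreal (4 * pi) * (\<Sum>m. ennreal ((cmod (cinner (taylor_coeff f m) (e n)))\<^sup>2))" .
  qed auto
  also have "\<dots> = ennreal (4 * pi) * (\<Sum>n m. ennreal ((cmod (cinner (taylor_coeff f m) (e n)))\<^sup>2))"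
    by simp
  also have "\<dots> \<le> ennreal (4 * pi) * (\<Sum>m. ennreal ((norm (taylor_coeff f m))\<^sup>2))"
  proof (intro mult_left_mono ennreal_suminf_suminf_le)
    show "(\<Sum>n<N. ennreal ((cmod (cinner (taylor_coeff f m) (e n)))\<^sup>2)) \<le> ennreal ((norm (taylor_coeff f m))\<^sup>2)" for N m
      using bessel_sum[OF e] by (subst sum_ennreal) (auto intro: ennreal_leI)
  qed simp
  finally show ?thesis by (simp add: H2)
qed

lemma row_symbol_BMOA_C: "row_symbol e \<in> BMOA_C"
proof -
  have "(SUP f\<in>Hol_ext1. \<integral>\<^sup>+ z\<in>unit_disc.
      ennreal ((norm (cblinfun_apply (Dop (row_symbol e) z) (f (cnj z))))\<^sup>2 * (1 - (cmod z)\<^sup>2)) \<partial>lborel)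
      \<le> ennreal (4 * pi)"
    by (intro SUP_least row_symbol_integral_le)
  then show ?thesis
    using row_symbol_Hol unfolding BMOA_C_def BMOA_C_norm_def mem_Collect_eq esqrt_less_top_iff
    by (auto intro: le_less_trans)
qed

section \<open>Failure of the area condition for the adjoint symbol\<close>

lemma const_Hol_ext1: "(\<lambda>_. e 0) \<in> Hol_ext1"
proof -
  define a where "a n = (if n = 0 then e 0 else 0)" for n :: nat
  have summ: "summable (\<lambda>n. norm (a n) * s ^ n)" for s :: real
    by (rule summable_finite[of "{0}"]) (auto simp: a_def)
  have eq: "e 0 = (\<Sum>n. z ^ n *\<^sub>C a n)" for z
  proof -
    have "(\<Sum>n. z ^ n *\<^sub>C a n) = (\<Sum>n\<in>{0}. z ^ n *\<^sub>C a n)"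
      by (rule suminf_finite) (auto simp: a_def)
    then show ?thesis by (simp add: a_def)
  qed
  have an: "analytic_in (\<lambda>_. e 0) (ball 0 r)" for r
    by (rule analytic_in_powser[OF summ eq])
  have tc: "taylor_coeff (\<lambda>_. e 0) n = a n" for n
    by (rule taylor_coeff_powser[where r = 1, OF summ eq]) simp
  have "(\<Sum>n. ennreal ((norm (a n))\<^sup>2)) = (\<Sum>n\<in>{0}. ennreal ((norm (a n))\<^sup>2))"
    by (rule suminf_finite) (auto simp: a_def)
  then have "H2_norm (\<lambda>_. e 0) = 1"
    unfolding H2_norm_def tc esqrt_eq_1_iff by (simp add: a_def norm_e)
  moreover have "(\<lambda>_. e 0) \<in> Hol_ext"
    unfolding Hol_ext_def Hol_def using an by (auto intro!: exI[of _ 2] exI[of _ "\<lambda>_. e 0"])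
  ultimately show ?thesis by (simp add: Hol_ext1_def)
qed

text \<open>By Bessel, the squared norm of the differentiated symbol at \<open>e 0\<close> is at
  least the partial sums of \<open>(n + 1) r^(2n)\<close>. Integrating term by term gives
  \<open>pi / (n + 2)\<close>, a divergent series.\<close>

lemma sharp_row_symbol_not_BMOA_C: "sharp (row_symbol e) \<notin> BMOA_C"
proof
  let ?I = "\<lambda>f. \<integral>\<^sup>+ z\<in>unit_disc. ennreal ((norm (cblinfun_apply (Dop (sharp (row_symbol e)) z)
    (f (cnj z))))\<^sup>2 * (1 - (cmod z)\<^sup>2)) \<partial>lborel"
  assume "sharp (row_symbol e) \<in> BMOA_C"
  then have "(SUP f\<in>Hol_ext1. ?I f) < \<infinity>"
    unfolding BMOA_C_def BMOA_C_norm_def mem_Collect_eq esqrt_less_top_iff by blast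
  moreover have "?I (\<lambda>_. e 0) \<le> (SUP f\<in>Hol_ext1. ?I f)"
    by (rule SUP_upper[OF const_Hol_ext1])
  ultimately have "?I (\<lambda>_. e 0) < \<infinity>" by (rule le_less_trans[rotated])
  then obtain C where C: "?I (\<lambda>_. e 0) = ennreal C" "0 \<le> C"
    by (rule ennreal_less_topE)
  \<comment> \<open>The lower bound for the integral is \<open>pi\<close> times this harmonic sum,
    so the sum must exceed \<open>C / pi\<close>.\<close>
  obtain N where N: "C / pi < (\<Sum>n<N. 1 / real (n + 2))"
    using harmonic_sum_unbounded by blast
  have "ennreal (pi * (\<Sum>n<N. 1 / real (n + 2))) = ennreal (\<Sum>n<N. pi / real (n + 2))"
    by (simp only: sum_distrib_left times_divide_eq_right mult_1_right)
  also have "\<dots> = (\<Sum>n<N. ennreal (pi / real (n + 2)))"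
    by (rule sum_ennreal[symmetric]) simp
  also have "\<dots> = (\<Sum>n<N. ennreal (real (n + 1)) *
      (\<integral>\<^sup>+ z \<in> unit_disc. ennreal (cmod z ^ (2 * n) * (1 - (cmod z)\<^sup>2)) \<partial>lborel))"
  proof (intro sum.cong refl)
    fix n
    have "pi / real (n + 2) = real (n + 1) * (pi / (real (n + 1) * real (n + 2)))"
      by (simp del: of_nat_add)
    then show "ennreal (pi / real (n + 2)) = ennreal (real (n + 1)) *
        (\<integral>\<^sup>+ z \<in> unit_disc. ennreal (cmod z ^ (2 * n) * (1 - (cmod z)\<^sup>2)) \<partial>lborel)"
      unfolding nn_integral_disc_power_weighted by (simp only: ennreal_mult' of_nat_0_le_iff of_nat_mult)
  qed
  also have "\<dots> = (\<integral>\<^sup>+ z. (\<Sum>n<N. ennreal (real (n + 1)) *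
      (ennreal (cmod z ^ (2 * n) * (1 - (cmod z)\<^sup>2)) * indicator unit_disc z)) \<partial>lborel)"
  proof -
    have [measurable]: "unit_disc \<in> sets borel" by simp
    show ?thesis by (subst nn_integral_sum) (auto simp: nn_integral_cmult)
  qed
  also have "\<dots> \<le> ?I (\<lambda>_. e 0)"
  proof (rule nn_integral_mono)
    fix z :: complex
    let ?w = "cblinfun_apply (Dop (sharp (row_symbol e)) z) (e 0)"
    show "(\<Sum>n<N. ennreal (real (n + 1)) *
        (ennreal (cmod z ^ (2 * n) * (1 - (cmod z)\<^sup>2)) * indicator unit_disc z))
        \<le> ennreal ((norm ?w)\<^sup>2 * (1 - (cmod z)\<^sup>2)) * indicator unit_disc z"
    proof (cases "z \<in> unit_disc")
      case True
      then have z: "cmod z < 1" by simp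
      have "cinner ?w (e m) = z ^ m * of_real (sqrt (m + 1))" for m
      proof -
        have "(\<lambda>n. cinner ((z ^ n * of_real (sqrt (n + 1))) *\<^sub>C e n) (e m)) sums cinner ?w (e m)"
          by (intro bounded_linear.sums[OF bounded_linear_cinner_left] Dop_sharp_row_symbol_sums z)
        also have "(\<lambda>n. cinner ((z ^ n * of_real (sqrt (n + 1))) *\<^sub>C e n) (e m))
            = (\<lambda>n. if n = m then z ^ n * of_real (sqrt (n + 1)) else 0)"
          by (auto simp: fun_eq_iff cinner_scaleC_left orthonormal_seqD[OF e])
        finally show ?thesis
          using sums_single[of m "\<lambda>n. z ^ n * of_real (sqrt (n + 1))"] by (rule sums_unique2)
      qed
      then have "(cmod (cinner ?w (e m)))\<^sup>2 = real (m + 1) * cmod z ^ (2 * m)" for m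
        by (simp add: norm_mult norm_power power_mult_distrib mult.commute flip: power_mult)
      then have "(\<Sum>n<N. real (n + 1) * cmod z ^ (2 * n)) \<le> (norm ?w)\<^sup>2"
        using bessel_sum[OF e, of ?w N] by simp
      then have "(\<Sum>n<N. real (n + 1) * cmod z ^ (2 * n)) * (1 - (cmod z)\<^sup>2) \<le> (norm ?w)\<^sup>2 * (1 - (cmod z)\<^sup>2)"
        using z by (intro mult_right_mono) (auto simp: power_le_one)
      then have "ennreal (\<Sum>n<N. real (n + 1) * (cmod z ^ (2 * n) * (1 - (cmod z)\<^sup>2)))
          \<le> ennreal ((norm ?w)\<^sup>2 * (1 - (cmod z)\<^sup>2))"
        by (intro ennreal_leI) (simp only: sum_distrib_right mult.assoc)
      moreover have "ennreal (\<Sum>n<N. real (n + 1) * (cmod z ^ (2 * n) * (1 - (cmod z)\<^sup>2)))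
          = (\<Sum>n<N. ennreal (real (n + 1)) * ennreal (cmod z ^ (2 * n) * (1 - (cmod z)\<^sup>2)))"
        using z by (subst sum_ennreal[symmetric])
          (auto simp: power_le_one ennreal_mult' intro!: mult_nonneg_nonneg sum.cong)
      ultimately show ?thesis using True by simp
    qed simp
  qed
  also have "\<dots> = ennreal C" by (rule C)
  finally have "pi * (\<Sum>n<N. 1 / real (n + 2)) \<le> C"
    using C(2) by (simp add: ennreal_le_iff)
  moreover have "C < pi * (\<Sum>n<N. 1 / real (n + 2))"
    using mult_strict_left_mono[OF N pi_gt_zero] by simp
  ultimately show False by simp
qed

section \<open>Unboundedness of the Hankel operator\<close>

text \<open>The test polynomial aligns its \<open>n\<close>-th coefficient with the
  \<open>n\<close>-th functional of the symbol, so all terms add up along \<open>e 0\<close>. The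
  constant coefficient of the image is \<open>L e 0\<close>, with \<open>L\<close> as large as
  desired.\<close>

lemma row_symbol_not_BMOA_NP: "row_symbol e \<notin> BMOA_NP"
proof
  assume "row_symbol e \<in> BMOA_NP"
  then have "(SUP f\<in>Hol_ext1. H2_norm (hankel (row_symbol e) f)) < \<infinity>"
    unfolding BMOA_NP_def by blast
  then obtain C where C: "(SUP f\<in>Hol_ext1. H2_norm (hankel (row_symbol e) f)) = ennreal C" "0 \<le> C"
    by (rule ennreal_less_topE)
  \<comment> \<open>The harmonic sum is \<open>L^2\<close>, whereas the norm to be compared with
    \<open>C\<close> is \<open>L\<close>; hence the square.\<close>
  obtain N where N: "C\<^sup>2 < (\<Sum>n<N. 1 / real (n + 1))"
    using harmonic_sum_unbounded by blast
  define L where "L = sqrt (\<Sum>n<N. 1 / real (n + 1))"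
  have L2: "L\<^sup>2 = (\<Sum>n<N. 1 / real (n + 1))"
    unfolding L_def by (intro real_sqrt_pow2 sum_nonneg) simp
  have "C < L" using N C(2) unfolding L_def by (rule_tac real_less_rsqrt)
  then have L: "0 < L" using C(2) by simp
  \<comment> \<open>Division by \<open>L\<close> normalises the test function: the squares of
    \<open>1 / sqrt (n + 1)\<close> for \<open>n < N\<close> sum to \<open>L^2\<close>.\<close>
  define d where "d n = 1 / sqrt (n + 1) / L" for n :: nat
  define a where "a n = (if n < N then d n *\<^sub>R e n else 0)" for n
  define f where "f z = (\<Sum>n. z ^ n *\<^sub>C a n)" for z :: complex
  have summ: "summable (\<lambda>n. norm (a n) * s ^ n)" for s :: real
    by (rule summable_finite[of "{..<N}"]) (auto simp: a_def)
  have an: "analytic_in f (ball 0 r)" for r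
    by (rule analytic_in_powser[OF summ]) (simp add: f_def)
  have tc: "taylor_coeff f n = a n" for n
    by (rule taylor_coeff_powser[where r = 1, OF summ]) (simp_all add: f_def)
  have "(\<Sum>n. ennreal ((norm (a n))\<^sup>2)) = (\<Sum>n<N. ennreal ((norm (a n))\<^sup>2))"
    by (rule suminf_finite) (auto simp: a_def)
  also have "\<dots> = ennreal (\<Sum>n<N. (norm (a n))\<^sup>2)" by (rule sum_ennreal) simp
  also have "(\<Sum>n<N. (norm (a n))\<^sup>2) = (\<Sum>n<N. 1 / real (n + 1)) / L\<^sup>2"
    unfolding sum_divide_distrib
    by (intro sum.cong) (simp_all add: a_def d_def norm_e power_divide power_mult_distrib)
  also have "\<dots> = 1" unfolding L2[symmetric] using L by simp
  finally have "H2_norm f = 1"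
    unfolding H2_norm_def tc esqrt_eq_1_iff by simp
  moreover have "f \<in> Hol_ext"
    unfolding Hol_ext_def Hol_def using an by (auto intro!: exI[of _ 2] exI[of _ f])
  ultimately have f1: "f \<in> Hol_ext1" by (simp add: Hol_ext1_def)
  define b where "b n = (\<Sum>m. cblinfun_apply (taylor_coeff (row_symbol e) (m + n)) (taylor_coeff f m))" for n
  have "taylor_coeff (hankel (row_symbol e) f) 0 = hankel (row_symbol e) f 0"
    by (simp add: taylor_coeff_def)
  \<comment> \<open>At the origin only the term \<open>n = 0\<close> of the outer series survives,
    so its convergence elsewhere does not enter.\<close>
  also have "\<dots> = b 0"
    using powser_sums_at_0[of b] unfolding hankel_def b_def[symmetric] by (simp add: sums_iff)
  also have "b 0 = (\<Sum>m<N. cblinfun_apply (taylor_coeff (row_symbol e) m) (a m))"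
    unfolding b_def tc add_0_right
    by (rule suminf_finite) (auto simp: a_def taylor_coeff_row_symbol cblinfun_apply_scaleR)
  also have "\<dots> = (\<Sum>m<N. (1 / real (m + 1) / L) *\<^sub>R e 0)"
  proof (intro sum.cong refl)
    fix m assume "m \<in> {..<N}"
    then have "cinner (a m) (e m) = of_real (d m)"
      by (simp add: a_def cinner_scaleR_left orthonormal_seqD[OF e] scaleR_conv_of_real)
    then have "cblinfun_apply (taylor_coeff (row_symbol e) m) (a m)
        = (1 / sqrt (real (m + 1))) *\<^sub>R (d m *\<^sub>R e 0)"
      by (simp only: taylor_coeff_row_symbol cblinfun_apply_scaleR rank_one_apply scaleC_of_real)
    then show "cblinfun_apply (taylor_coeff (row_symbol e) m) (a m) = (1 / real (m + 1) / L) *\<^sub>R e 0"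
      by (simp add: d_def)
  qed
  also have "\<dots> = (L\<^sup>2 / L) *\<^sub>R e 0"
    by (simp add: L2 sum_divide_distrib flip: scaleR_sum_left)
  finally have "norm (taylor_coeff (hankel (row_symbol e) f) 0) = L"
    using L by (simp add: norm_e power2_eq_square)
  then have "ennreal L \<le> H2_norm (hankel (row_symbol e) f)"
    using norm_le_H2_norm[of "hankel (row_symbol e) f" 0] by simp
  also have "\<dots> \<le> ennreal C" unfolding C(1)[symmetric] by (rule SUP_upper[OF f1])
  finally show False using \<open>C < L\<close> C(2) by (simp add: ennreal_le_iff)
qed

end

theorem corollary1p8:
  assumes "separable_space (euclidean :: 'h::chilbert_space topology)"
    and "infinite_dimensional TYPE('h)"
  shows "\<not> (\<forall>\<phi> \<in> (BMOA_C :: (complex \<Rightarrow> ('h, 'h) cblinfun) set). sharp \<phi> \<in> BMOA_C) \<and>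
    (BMOA_C :: (complex \<Rightarrow> ('h, 'h) cblinfun) set) \<noteq> BMOA_NP"
proof -
  obtain e :: "nat \<Rightarrow> 'h" where "orthonormal_seq e"
    using ex_orthonormal_seq[OF assms(2)] by blast
  then interpret hilbert_orthonormal_seq e by unfold_locales
  \<comment> \<open>One symbol settles both claims: it lies in \<open>BMOA_C\<close>, its image
    under \<open>sharp\<close> does not, and it is outside \<open>BMOA_NP\<close>.\<close>
  show ?thesis
    using row_symbol_BMOA_C sharp_row_symbol_not_BMOA_C row_symbol_not_BMOA_NP by blast
qed

end
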